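(* Let $\boldsymbol{g}:\Theta\subseteq\mathbb{R}^p\to\mathbb{R}^r$, $r<p$, be such that the $p\times r$ matrix $\boldsymbol{G}(\boldsymbol{\theta})=\partial\boldsymbol{g}^T(\boldsymbol{\theta})/\partial\boldsymbol{\theta}$ exists, is continuous in $\boldsymbol{\theta}$ and has rank $r$. Let $\boldsymbol{y}_1,\dots,\boldsymbol{y}_n$ be i.i.d. observations from $f(\cdot;\boldsymbol{\theta})$, where the true parameter $\boldsymbol{\theta}$ satisfies the constraints $\boldsymbol{g}(\boldsymbol{\theta})=\boldsymbol{0}_r$, and let $\widetilde{\boldsymbol{\theta}}_{rc}$ be the restricted maximum composite likelihood estimator. Assume the regularity assumptions of the context. Then $$\sqrt{n}(\widetilde{\boldsymbol{\theta}}_{rc}-\boldsymbol{\theta})\xrightarrow[n\to\infty]{\mathcal{L}}\mathcal{N}(\boldsymbol{0}_p,\widetilde{\boldsymbol{\Sigma}}_{rc}),\qquad \widetilde{\boldsymbol{\Sigma}}_{rc}=\boldsymbol{P}(\boldsymbol{\theta})\boldsymbol{J}(\boldsymbol{\theta})\boldsymbol{P}^T(\boldsymbol{\theta}),$$ where $$\boldsymbol{P}(\boldsymbol{\theta})=\boldsymbol{H}^{-1}(\boldsymbol{\theta})+\boldsymbol{Q}(\boldsymbol{\theta})\boldsymbol{G}^T(\boldsymbol{\theta})\boldsymbol{H}^{-1}(\boldsymbol{\theta}),\qquad \boldsymbol{Q}(\boldsymbol{\theta})=-\boldsymbol{H}^{-1}(\boldsymbol{\theta})\boldsymbol{G}(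\boldsymbol{\theta})\left[\boldsymbol{G}^T(\boldsymbol{\theta})\boldsymbol{H}^{-1}(\boldsymbol{\theta})\boldsymbol{G}(\boldsymbol{\theta})\right]^{-1}.$$
   Context: Model and composite likelihood. $\{f(\cdot;\boldsymbol{\theta}):\boldsymbol{\theta}\in\Theta\subseteq\mathbb{R}^p\}$, $p\ge1$, is an identifiable parametric family of densities of a random vector $\boldsymbol{Y}$ in $\mathbb{R}^m$; $E_{\boldsymbol{\theta}}$, $Var_{\boldsymbol{\theta}}$ refer to $\boldsymbol{Y}\sim f(\cdot;\boldsymbol{\theta})$. Given $K$ marginal or conditional densities $f_{A_k}(y_j,j\in A_k;\boldsymbol{\theta})$ derived from $f(\cdot;\boldsymbol{\theta})$ and known weights $w_k\ge0$, the composite density is $\mathcal{CL}(\boldsymbol{\theta},\boldsymbol{y})=\prod_{k=1}^K f_{A_k}^{w_k}(y_j,j\in A_k;\boldsymbol{\theta})$ and the composite log-density is $c\ell(\boldsymbol{\theta},\boldsymbol{y})=\log\mathcal{CL}(\boldsymbol{\theta},\boldsymbol{y})$. The score is $\boldsymbol{u}(\boldsymbol{\theta},\boldsymbol{y})=\partial c\ell(\boldsymbol{\theta},\boldsymbol{y})/\partial\boldsymbol{\theta}$. Restricted estimator. $\widetilde{\boldsymbol{\theta}}_{rc}$ maximizes $\sum_{i=1}^n c\ell(\boldsymbol{\theta},\boldsymbol{y}_i)$ over $\{\boldsymbol{\theta}\in\Theta:\boldsymbol{g}(\boldsymbol{\theta})=\boldsymbol{0}_r\}$ and is obtained as a solution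 of the restricted likelihood equations $\sum_{i=1}^n\boldsymbol{u}(\boldsymbol{\theta},\boldsymbol{y}_i)+\boldsymbol{G}(\boldsymbol{\theta})\boldsymbol{\lambda}=\boldsymbol{0}_p$, $\boldsymbol{g}(\boldsymbol{\theta})=\boldsymbol{0}_r$, with $\boldsymbol{\lambda}\in\mathbb{R}^r$ a vector of Lagrange multipliers. Matrices. $\boldsymbol{H}(\boldsymbol{\theta})=E_{\boldsymbol{\theta}}[-\frac{\partial}{\partial\boldsymbol{\theta}}\boldsymbol{u}^T(\boldsymbol{\theta},\boldsymbol{Y})]$ and $\boldsymbol{J}(\boldsymbol{\theta})=Var_{\boldsymbol{\theta}}[\boldsymbol{u}(\boldsymbol{\theta},\boldsymbol{Y})]=E_{\boldsymbol{\theta}}[\boldsymbol{u}(\boldsymbol{\theta},\boldsymbol{Y})\boldsymbol{u}^T(\boldsymbol{\theta},\boldsymbol{Y})]$, both assumed positive definite. Regularity assumptions (the standard ones of asymptotic statistics). The true parameter is interior to $\Theta$; the set $\{\boldsymbol{y}:\mathcal{CL}(\boldsymbol{\theta},\boldsymbol{y})>0\}$ does not depend on $\boldsymbol{\theta}$; for almost every $\boldsymbol{y}$, $c\ell(\cdot,\boldsymbol{y})$ is three times continuously differentiable near the true parameter, with third derivatives dominated by a function of $\boldsymbol{y}$ with finite expectation; $E_{\boldsymbol{\theta}}[\boldsymbol{u}(\boldsymbol{\theta},\boldsymbol{Y})]=\boldsymbol{0}_p$ and $\boldsymbol{H},\boldsymbol{J}$ are finite.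
   Formalization: The restricted maximum composite likelihood estimator is additionally assumed consistent (converging in probability to the true parameter); the listed local regularity assumptions allow inconsistent restricted maximizers, for which the claim fails. *)

theory Defs
  imports "HOL-Probability.Probability"
begin

subsection \<open>Parametric families of densities on \<open>\<real>\<^sup>m\<close>\<close>

text \<open>
  Densities are taken with respect to a product of \<open>\<sigma>\<close>-finite measures \<open>\<nu> j\<close> on the real line, one
  for each coordinate. For \<open>\<nu> j = lborel\<close> this is Lebesgue measure on \<open>\<real>\<^sup>m\<close>; counting measures on
  countable subsets give probability mass functions.
\<close>

definition reference_measure :: "('m::finite \<Rightarrow> real measure) \<Rightarrow> (real^'m) measure" where
  "reference_measure \<nu> = distr (PiM UNIV \<nu>) borel (\<lambda>z. \<chi> j. z j)"

definition model_law ::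
    "('m::finite \<Rightarrow> real measure) \<Rightarrow> ('t \<Rightarrow> real^'m \<Rightarrow> real) \<Rightarrow> 't \<Rightarrow> (real^'m) measure" where
  "model_law \<nu> f \<theta> = density (reference_measure \<nu>) (\<lambda>y. ennreal (f \<theta> y))"

definition identifiable_density_family ::
    "('m::finite \<Rightarrow> real measure) \<Rightarrow> 't set \<Rightarrow> ('t \<Rightarrow> real^'m \<Rightarrow> real) \<Rightarrow> bool" where
  "identifiable_density_family \<nu> \<Theta> f \<longleftrightarrow>
     (\<forall>j. sigma_finite_measure (\<nu> j) \<and> sets (\<nu> j) = sets borel) \<and>
     (\<forall>\<theta>\<in>\<Theta>. f \<theta> \<in> borel_measurable borel \<and> (\<forall>y. 0 \<le> f \<theta> y) \<and> prob_space (model_law \<nu> f \<theta>)) \<and>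
     inj_on (model_law \<nu> f) \<Theta>"


subsection \<open>Composite densities\<close>

text \<open>
  \<open>Marginal A\<close> is the density of \<open>(Y\<^sub>j)\<close>, \<open>j \<in> A\<close>; \<open>Conditional A B\<close> is the density of \<open>(Y\<^sub>j)\<close>, \<open>j \<in> A\<close>,
  given \<open>(Y\<^sub>j)\<close>, \<open>j \<in> B\<close>. Both are regarded as functions of the full vector \<open>y\<close>.
\<close>

datatype 'm component = Marginal "'m set" | Conditional "'m set" "'m set"

fun valid_component :: "'m component \<Rightarrow> bool" where
  "valid_component (Marginal A) \<longleftrightarrow> A \<noteq> {}"
| "valid_component (Conditional A B) \<longleftrightarrow> A \<noteq> {} \<and> B \<noteq> {} \<and> A \<inter> B = {}"

definition marginal_density ::
    "('m::finite \<Rightarrow> real measure) \<Rightarrow> (real^'m \<Rightarrow> real) \<Rightarrow> 'm set \<Rightarrow> real^'m \<Rightarrow> real" where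
  "marginal_density \<nu> \<phi> A y = (\<integral>z. \<phi> (\<chi> j. if j \<in> A then y $ j else z j) \<partial>(PiM (- A) \<nu>))"

fun component_density ::
    "('m::finite \<Rightarrow> real measure) \<Rightarrow> (real^'m \<Rightarrow> real) \<Rightarrow> 'm component \<Rightarrow> real^'m \<Rightarrow> real" where
  "component_density \<nu> \<phi> (Marginal A) y = marginal_density \<nu> \<phi> A y"
| "component_density \<nu> \<phi> (Conditional A B) y =
     marginal_density \<nu> \<phi> (A \<union> B) y / marginal_density \<nu> \<phi> B y"

text \<open>Since \<open>0 powr 0 = 0\<close>, factors with weight zero are set to one explicitly.\<close>

definition weighted_factor :: "real \<Rightarrow> real \<Rightarrow> real" where
  "weighted_factor x w = (if w = 0 then 1 else x powr w)"

definition composite_density ::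
    "('m::finite \<Rightarrow> real measure) \<Rightarrow> ('t \<Rightarrow> real^'m \<Rightarrow> real) \<Rightarrow> nat \<Rightarrow> (nat \<Rightarrow> 'm component) \<Rightarrow>
     (nat \<Rightarrow> real) \<Rightarrow> 't \<Rightarrow> real^'m \<Rightarrow> real" where
  "composite_density \<nu> f K cmp w \<theta> y =
     (\<Prod>k<K. weighted_factor (component_density \<nu> (f \<theta>) (cmp k) y) (w k))"


subsection \<open>Derivatives with respect to the parameter\<close>

definition partial :: "'p::finite \<Rightarrow> (real^'p \<Rightarrow> real) \<Rightarrow> real^'p \<Rightarrow> real" where
  "partial i F \<theta> = frechet_derivative F (at \<theta>) (axis i 1)"

fun continuously_differentiable :: "nat \<Rightarrow> (real^'p::finite) set \<Rightarrow> (real^'p \<Rightarrow> real) \<Rightarrow> bool" where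
  "continuously_differentiable 0 U F \<longleftrightarrow> continuous_on U F"
| "continuously_differentiable (Suc k) U F \<longleftrightarrow>
     (\<forall>\<theta>\<in>U. F differentiable (at \<theta>)) \<and> (\<forall>i. continuously_differentiable k U (partial i F))"

definition score :: "(real^'p::finite \<Rightarrow> 'y \<Rightarrow> real) \<Rightarrow> real^'p \<Rightarrow> 'y \<Rightarrow> real^'p" where
  "score cl \<theta> y = (\<chi> i. partial i (\<lambda>t. cl t y) \<theta>)"

text \<open>The entry in row \<open>i\<close> and column \<open>j\<close> is the derivative of \<open>g\<^sub>j\<close> in the direction of \<open>\<theta>\<^sub>i\<close>.\<close>

definition constraint_matrix :: "(real^'p::finite \<Rightarrow> real^'r::finite) \<Rightarrow> real^'p \<Rightarrow> real^'r^'p" where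
  "constraint_matrix g \<theta> = transpose (matrix (frechet_derivative g (at \<theta>)))"


subsection \<open>The matrices of the asymptotic theory\<close>

text \<open>The measure \<open>L\<close> below is the law of \<open>Y\<close> at the parameter \<open>\<theta>\<close>.\<close>

definition sensitivity_matrix ::
    "'y measure \<Rightarrow> (real^'p::finite \<Rightarrow> 'y \<Rightarrow> real) \<Rightarrow> real^'p \<Rightarrow> real^'p^'p" where
  "sensitivity_matrix L cl \<theta> =
     (\<chi> i j. \<integral>y. - partial i (\<lambda>t. score cl t y $ j) \<theta> \<partial>L)"

definition variability_matrix ::
    "'y measure \<Rightarrow> (real^'p::finite \<Rightarrow> 'y \<Rightarrow> real) \<Rightarrow> real^'p \<Rightarrow> real^'p^'p" where
  "variability_matrix L cl \<theta> =
     (\<chi> i j. \<integral>y. (score cl \<theta> y $ i - (\<integral>x. score cl \<theta> x $ i \<partial>L)) *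
                 (score cl \<theta> y $ j - (\<integral>x. score cl \<theta> x $ j \<partial>L)) \<partial>L)"

definition positive_definite :: "real^'n^'n::finite \<Rightarrow> bool" where
  "positive_definite A \<longleftrightarrow> transpose A = A \<and> (\<forall>x. x \<noteq> 0 \<longrightarrow> 0 < x \<bullet> (A *v x))"

definition Q_matrix :: "real^'p^'p::finite \<Rightarrow> real^'r::finite^'p \<Rightarrow> real^'r^'p" where
  "Q_matrix H G = - (matrix_inv H ** G ** matrix_inv (transpose G ** matrix_inv H ** G))"

definition P_matrix :: "real^'p^'p::finite \<Rightarrow> real^'r::finite^'p \<Rightarrow> real^'p^'p" where
  "P_matrix H G = matrix_inv H + Q_matrix H G ** transpose G ** matrix_inv H"


subsection \<open>The restricted estimator\<close>

definition restricted_maximizer ::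
    "(real^'p::finite) set \<Rightarrow> (real^'p \<Rightarrow> real^'r::finite) \<Rightarrow> (real^'p \<Rightarrow> 'y \<Rightarrow> real) \<Rightarrow>
     nat \<Rightarrow> (nat \<Rightarrow> 'y) \<Rightarrow> real^'p \<Rightarrow> bool" where
  "restricted_maximizer \<Theta> g cl n ys t \<longleftrightarrow>
     t \<in> \<Theta> \<and> g t = 0 \<and>
     (\<forall>s\<in>\<Theta>. g s = 0 \<longrightarrow> (\<Sum>i<n. cl s (ys i)) \<le> (\<Sum>i<n. cl t (ys i)))"

definition restricted_likelihood_equations ::
    "(real^'p::finite \<Rightarrow> real^'r::finite) \<Rightarrow> (real^'p \<Rightarrow> 'y \<Rightarrow> real) \<Rightarrow>
     nat \<Rightarrow> (nat \<Rightarrow> 'y) \<Rightarrow> real^'p \<Rightarrow> bool" where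
  "restricted_likelihood_equations g cl n ys t \<longleftrightarrow>
     (\<exists>lam. (\<Sum>i<n. score cl t (ys i)) + constraint_matrix g t *v lam = 0) \<and> g t = 0"


subsection \<open>Asymptotics\<close>

definition with_probability_tending_to_one ::
    "'a measure \<Rightarrow> (nat \<Rightarrow> 'a \<Rightarrow> bool) \<Rightarrow> bool" where
  "with_probability_tending_to_one M \<Phi> \<longleftrightarrow>
     (\<exists>E. (\<forall>n. E n \<in> sets M \<and> (\<forall>\<omega>\<in>E n. \<Phi> n \<omega>)) \<and> (\<lambda>n. measure M (E n)) \<longlonglongrightarrow> 1)"

definition converges_in_probability ::
    "'a measure \<Rightarrow> (nat \<Rightarrow> 'a \<Rightarrow> 'b::metric_space) \<Rightarrow> 'b \<Rightarrow> bool" where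
  "converges_in_probability M X c \<longleftrightarrow>
     (\<forall>\<epsilon>>0. (\<lambda>n. measure M {\<omega> \<in> space M. \<epsilon> \<le> dist (X n \<omega>) c}) \<longlonglongrightarrow> 0)"

definition converges_in_law ::
    "'a measure \<Rightarrow> (nat \<Rightarrow> 'a \<Rightarrow> 'b::metric_space) \<Rightarrow> 'b measure \<Rightarrow> bool" where
  "converges_in_law M X N \<longleftrightarrow>
     (\<forall>h :: 'b \<Rightarrow> real. continuous_on UNIV h \<and> bounded (range h) \<longrightarrow>
        (\<lambda>n. \<integral>\<omega>. h (X n \<omega>) \<partial>M) \<longlonglongrightarrow> (\<integral>x. h x \<partial>N))"

definition standard_normal_vector :: "(real^'n::finite) measure" where
  "standard_normal_vector =
     distr (PiM UNIV (\<lambda>_. density lborel (\<lambda>x. ennreal (std_normal_density x)))) borel (\<lambda>z. \<chi> i. z i)"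

text \<open>
  \<open>N\<close> is the law of \<open>\<mu> + A Z\<close> with \<open>Z\<close> standard normal and \<open>A A\<^sup>T = \<Sigma>\<close>; it depends on \<open>A\<close> only through
  \<open>\<Sigma>\<close>. The covariance matrix may be singular, as it is for restricted estimators, so a definition by
  a density is not available.
\<close>

definition is_multivariate_normal ::
    "real^'n::finite \<Rightarrow> real^'n^'n \<Rightarrow> (real^'n) measure \<Rightarrow> bool" where
  "is_multivariate_normal \<mu> \<Sigma> N \<longleftrightarrow>
     (\<exists>A :: real^'n^'n. A ** transpose A = \<Sigma> \<and>
        N = distr standard_normal_vector borel (\<lambda>z. \<mu> + A *v z))"

end

theory Submission
  imports Defs
begin

text \<open>
  Write \<open>d = \<surd>n (est - \<theta>\<^sub>0)\<close> and let \<open>s\<close> be the normalized score \<open>n\<^sup>-\<^sup>1\<^sup>/\<^sup>2 \<Sum> u(\<theta>\<^sub>0, Y\<^sub>i)\<close>. A second order expansion of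
  the score turns the restricted likelihood equations into a small perturbation of the linear system
  \<open>s - H d + G l = 0\<close>, \<open>G\<^sup>T d = 0\<close>, whose solution is \<open>d = P s\<close>; the size of the perturbation is controlled
  by consistency and the weak law of large numbers, and it costs only a relative error, so that
  \<open>d - P s\<close> tends to \<open>0\<close> in probability. The univariate central limit theorem applied to \<open>t \<bullet> P s\<close> gives
  the limits of the expectations of \<open>cos (t \<bullet> d)\<close> and \<open>sin (t \<bullet> d)\<close>. Together with tightness this
  suffices for convergence in law, because trigonometric polynomials approximate every bounded
  continuous function uniformly on balls without exceeding its bound by much elsewhere.
\<close>

section \<open>Restricted linear equations\<close>

text \<open>Consistency gives no rate, so \<open>d\<close> is not known to be bounded in probability
  when the equations are perturbed, and the multiplier has no a priori bound at all. Every error is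
  therefore measured relative to \<open>norm d\<close> or \<open>norm l\<close>: the quadratic
  remainder of the score, divided by the square root of n, has the order of
  \<open>norm (est - \<theta>\<^sub>0)\<close> times \<open>norm d\<close>, and differentiability of
  \<open>g\<close> at the true parameter makes G^T d small relative to \<open>norm d\<close>. Linear
  algebra absorbs these terms and returns an error relative to \<open>norm s\<close>. Only there
  does a second moment bound supply tightness, and the root-n rate comes out as a consequence. The
  matrix P is singular because P G = 0, so the limit law has no Lebesgue density and is degenerate
  in some directions. It is built as the image of a standard normal vector under P B with B B^T = J,
  and vanishing directions P^T t = 0 are separated before the central limit theorem is
  applied.\<close>

lemma invertible_matrix_inv:
  fixes A :: "real^'n^'n"
  assumes "invertible A"
  shows "A ** matrix_inv A = mat 1" "matrix_inv A ** A = mat 1"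
  using someI_ex[OF assms[unfolded invertible_def]] by (auto simp: matrix_inv_def)

section \<open>Positive definite matrices\<close>

lemma positive_definite_invertible:
  assumes "positive_definite A"
  shows "invertible A"
proof -
  have "x = 0" if "A *v x = 0" for x
    using assms that unfolding positive_definite_def by (metis inner_zero_right less_irrefl)
  then show ?thesis
    by (simp add: invertible_left_inverse matrix_left_invertible_ker)
qed

lemma positive_definite_matrix_inv:
  assumes "positive_definite A"
  shows "positive_definite (matrix_inv A)"
proof -
  note inv = invertible_matrix_inv[OF positive_definite_invertible[OF assms]]
  have sym: "transpose A = A" and pos: "\<And>x. x \<noteq> 0 \<Longrightarrow> 0 < x \<bullet> (A *v x)"
    using assms by (auto simp: positive_definite_def)
  have "transpose (matrix_inv A) ** A = mat 1"
    by (metis inv(1) matrix_transpose_mul sym transpose_mat)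
  then have tr: "transpose (matrix_inv A) = matrix_inv A"
    by (metis inv(1) matrix_mul_assoc matrix_mul_lid matrix_mul_rid)
  have "0 < x \<bullet> (matrix_inv A *v x)" if "x \<noteq> 0" for x
  proof -
    define z where "z = matrix_inv A *v x"
    have x: "x = A *v z"
      by (simp add: z_def matrix_vector_mul_assoc inv)
    then have "z \<noteq> 0" using that by auto
    then show ?thesis
      using pos[of z] by (simp add: z_def[symmetric] x[symmetric] inner_commute)
  qed
  with tr show ?thesis by (auto simp: positive_definite_def)
qed

text \<open>For \<open>A = matrix_inv H\<close> this makes the matrix inverted in
  \<open>Q_matrix\<close> genuinely invertible. Injectivity of \<open>G\<close> is the form in which
  full column rank is used.\<close>

lemma positive_definite_congruence:
  fixes A :: "real^'n^'n" and G :: "real^'r^'n"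
  assumes "positive_definite A" "inj ((*v) G)"
  shows "positive_definite (transpose G ** A ** G)"
proof -
  have "0 < x \<bullet> (transpose G ** A ** G *v x)" if "x \<noteq> 0" for x
  proof -
    have "G *v x \<noteq> 0"
      using assms(2) that by (metis injD matrix_vector_mult_0_right)
    then have "0 < (G *v x) \<bullet> (A *v (G *v x))"
      using assms(1) by (auto simp: positive_definite_def)
    also have "\<dots> = (x v* transpose G) \<bullet> (A *v (G *v x))"
      by simp
    also have "\<dots> = x \<bullet> (transpose G *v (A *v (G *v x)))"
      by (rule dot_lmul_matrix)
    also have "\<dots> = x \<bullet> (transpose G ** A ** G *v x)"
      by (simp only: matrix_vector_mul_assoc matrix_mul_assoc)
    finally show ?thesis .
  qed
  then show ?thesis
    using assms(1) by (simp add: positive_definite_def matrix_transpose_mul matrix_mul_assoc)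
qed

text \<open>The rows of a matrix \<open>V\<close> with \<open>V A V\<^sup>T = 1\<close> are chosen orthonormal for the inner product of
  \<open>A\<close>, one row at a time.\<close>

lemma positive_definite_factorization:
  fixes A :: "real^'n^'n"
  assumes "positive_definite A"
  obtains B :: "real^'n^'n" where "B ** transpose B = A"
proof -
  have pos: "\<And>x. x \<noteq> 0 \<Longrightarrow> 0 < x \<bullet> (A *v x)" and sym: "transpose A = A"
    using assms by (auto simp: positive_definite_def)
  have sym': "x \<bullet> (A *v y) = y \<bullet> (A *v x)" for x y
    by (metis dot_lmul_matrix inner_commute sym transpose_matrix_vector)
  have "\<exists>v :: 'n \<Rightarrow> real^'n. \<forall>i\<in>I. \<forall>j\<in>I. v i \<bullet> (A *v v j) = (if i = j then 1 else 0)"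
    if "finite I" for I
    using that
  proof (induction I rule: finite_induct)
    case empty
    show ?case by simp
  next
    case (insert k I)
    then obtain v :: "'n \<Rightarrow> real^'n"
      where v: "\<And>i j. i \<in> I \<Longrightarrow> j \<in> I \<Longrightarrow> v i \<bullet> (A *v v j) = (if i = j then 1 else 0)"
      by blast
    \<comment> \<open>Euclidean orthogonality to the vectors \<open>A *v v j\<close> is
      orthogonality to the \<open>v j\<close> for the inner product of \<open>A\<close>. There are
      fewer of these vectors than dimensions, which leaves room for a nonzero
      \<open>x\<close>.\<close>
    let ?S = "(\<lambda>j. A *v v j) ` I"
    have "dim ?S \<le> card I"
      using dim_le_card'[of ?S] card_image_le[of I] insert.hyps by (meson finite_imageI le_trans)
    also have "card I < card (insert k I)"
      using insert.hyps by simp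
    also have "\<dots> \<le> CARD('n)"
      by (intro card_mono) auto
    finally obtain x where x: "x \<noteq> 0" "\<And>y. y \<in> span ?S \<Longrightarrow> orthogonal x y"
      using orthogonal_to_subspace_exists[of ?S] by auto
    define c where "c = sqrt (x \<bullet> (A *v x))"
    have c: "c * c = x \<bullet> (A *v x)" "c \<noteq> 0"
      using pos[OF x(1)] by (auto simp: c_def)
    define u where "u = x /\<^sub>R c"
    have uu: "u \<bullet> (A *v u) = 1"
      using c by (simp add: u_def matrix_vector_mult_scaleR c(1)[symmetric] field_simps)
    have uv: "u \<bullet> (A *v v j) = 0" if "j \<in> I" for j
      using x(2)[OF span_base, of "A *v v j"] that by (auto simp: u_def orthogonal_def)
    show ?case
      by (rule exI[of _ "v(k := u)"]) (use uu uv v sym' insert.hyps in auto)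
  qed
  from this[of UNIV] obtain v :: "'n \<Rightarrow> real^'n"
    where v: "\<And>i j. v i \<bullet> (A *v v j) = (if i = j then 1 else 0)"
    by auto
  define V where "V = (\<chi> i. v i)"
  have "(V ** (A ** transpose V)) $ i $ j = v i \<bullet> (A *v v j)" for i j
    by (simp add: matrix_matrix_mult_def matrix_vector_mult_def inner_vec_def V_def transpose_def)
  then have V: "V ** (A ** transpose V) = mat 1"
    by (simp add: vec_eq_iff v mat_def)
  then have 1: "invertible V"
    by (metis invertible_right_inverse)
  note inv = invertible_matrix_inv[OF 1]
  show thesis
  proof
    have "transpose V ** transpose (matrix_inv V) = mat 1"
      by (simp add: matrix_transpose_mul[symmetric] inv)
    then have "A = (matrix_inv V ** V) ** A ** (transpose V ** transpose (matrix_inv V))"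
      by (simp add: inv)
    also have "\<dots> = matrix_inv V ** (V ** (A ** transpose V)) ** transpose (matrix_inv V)"
      by (simp only: matrix_mul_assoc)
    finally show "matrix_inv V ** transpose (matrix_inv V) = A"
      by (simp add: V)
  qed
qed

section \<open>Algebra of the matrices P and Q\<close>

lemma matrix_mult_minus:
  fixes A :: "real^'n^'m" and B :: "real^'k^'n"
  shows "(- A) ** B = - (A ** B)" "A ** (- B) = - (A ** B)"
  by (simp_all add: matrix_matrix_mult_def vec_eq_iff sum_negf)

lemma matrix_mult_add_right:
  fixes A B :: "real^'n^'m" and C :: "real^'k^'n"
  shows "(A + B) ** C = A ** C + B ** C"
  by (simp add: matrix_matrix_mult_def vec_eq_iff sum.distrib distrib_right)

text \<open>These two identities say that P solves the unperturbed system: applied to s - H d + G l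
  = 0, the first removes the multiplier, and the second leaves d alone because Q G^T vanishes on the
  tangent space G^T d = 0.\<close>

lemma P_matrix_identities:
  fixes H :: "real^'p^'p" and G :: "real^'r^'p"
  assumes "positive_definite H" "inj ((*v) G)"
  shows "P_matrix H G ** G = 0"
    and "P_matrix H G ** H = mat 1 + Q_matrix H G ** transpose G"
proof -
  define K where "K = transpose G ** matrix_inv H ** G"
  note H = invertible_matrix_inv[OF positive_definite_invertible[OF assms(1)]]
  have K: "matrix_inv K ** K = mat 1"
    unfolding K_def
    by (intro invertible_matrix_inv positive_definite_invertible positive_definite_congruence
        positive_definite_matrix_inv assms)
  have "P_matrix H G ** G = matrix_inv H ** G + Q_matrix H G ** K"
    by (simp add: P_matrix_def K_def matrix_mult_add_right matrix_mul_assoc)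
  also have "Q_matrix H G ** K = - (matrix_inv H ** G ** (matrix_inv K ** K))"
    by (simp add: Q_matrix_def K_def matrix_mult_minus matrix_mul_assoc)
  finally show "P_matrix H G ** G = 0"
    by (simp add: K)
  show "P_matrix H G ** H = mat 1 + Q_matrix H G ** transpose G"
    by (simp add: P_matrix_def matrix_mult_add_right matrix_mul_assoc[symmetric] H)
qed

text \<open>With \<open>1 \<le> c\<close> the powers of a common constant increase, so lower powers
  can be absorbed into higher ones.\<close>

lemma matrix_vector_bound:
  fixes A :: "real^'n^'m"
  obtains c where "1 \<le> c" "\<And>x. norm (A *v x) \<le> c * norm x"
proof -
  obtain c where "c > 0" "\<And>x. norm (A *v x) \<le> norm x * c"
    using bounded_linear.pos_bounded[OF matrix_vector_mul_bounded_linear] by blast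
  then have "norm (A *v x) \<le> max 1 c * norm x" for x
    by (metis dual_order.trans max.cobounded2 mult.commute mult_right_mono norm_ge_zero)
  then show thesis using that[of "max 1 c"] by simp
qed

text \<open>The perturbed equations determine \<open>d\<close> up to a relative error of order \<open>\<epsilon>\<close>: multiplication by
  \<open>P\<close> removes the leading term of the multiplier \<open>l\<close>, and \<open>l\<close> itself is controlled by a left inverse
  of \<open>G\<close>.\<close>

lemma perturbed_restricted_equations:
  fixes P H :: "real^'p^'p" and G Q :: "real^'r^'p"
  assumes PG: "P ** G = 0" and PH: "P ** H = mat 1 + Q ** transpose G"
    and inj: "inj ((*v) G)"
  obtains C \<epsilon>\<^sub>0 where "C > 0" "\<epsilon>\<^sub>0 > 0"
    "\<And>\<epsilon> s d l \<rho> A G'. 0 \<le> \<epsilon> \<Longrightarrow> \<epsilon> \<le> \<epsilon>\<^sub>0 \<Longrightarrow> s - A *v d + \<rho> + G' *v l = 0 \<Longrightarrow>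
       norm (A *v d - H *v d) \<le> \<epsilon> * norm d \<Longrightarrow> norm \<rho> \<le> \<epsilon> * norm d \<Longrightarrow>
       norm (G' *v l - G *v l) \<le> \<epsilon> * norm l \<Longrightarrow> norm (transpose G *v d) \<le> \<epsilon> * norm d \<Longrightarrow>
       norm (d - P *v s) \<le> C * \<epsilon> * norm s"
proof -
  obtain N where N: "N ** G = mat 1"
    using inj matrix_left_invertible_injective by blast
  obtain c1 where c1: "1 \<le> c1" "\<And>x. norm (P *v x) \<le> c1 * norm x"
    using matrix_vector_bound[of P] by blast
  obtain c2 where c2: "1 \<le> c2" "\<And>x. norm (Q *v x) \<le> c2 * norm x"
    using matrix_vector_bound[of Q] by blast
  obtain c3 where c3: "1 \<le> c3" "\<And>x. norm (N *v x) \<le> c3 * norm x"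
    using matrix_vector_bound[of N] by blast
  obtain c4 where c4: "1 \<le> c4" "\<And>x. norm (H *v x) \<le> c4 * norm x"
    using matrix_vector_bound[of H] by blast
  define c where "c = Max {c1, c2, c3, c4}"
  have le: "c1 \<le> c" "c2 \<le> c" "c3 \<le> c" "c4 \<le> c" by (auto simp: c_def)
  have c: "1 \<le> c" using c1(1) le(1) by linarith
  have cP: "norm (P *v x) \<le> c * norm x" for x
    using c1(2)[of x] mult_right_mono[OF le(1), of "norm x"] by simp
  have cQ: "norm (Q *v x) \<le> c * norm x" for x
    using c2(2)[of x] mult_right_mono[OF le(2), of "norm x"] by simp
  have cN: "norm (N *v x) \<le> c * norm x" for x
    using c3(2)[of x] mult_right_mono[OF le(3), of "norm x"] by simp
  have cH: "norm (H *v x) \<le> c * norm x" for x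
    using c4(2)[of x] mult_right_mono[OF le(4), of "norm x"] by simp
  have pw: "c \<le> c^2" "c^2 \<le> c^3" "1 \<le> c^2" "1 \<le> c^3"
    using c by (auto simp: power_increasing self_le_power one_le_power)
  show thesis
  proof
    \<comment> \<open>Since \<epsilon> c^3 is at most 1/10, the terms in \<open>d\<close> and
      \<open>l\<close> on the right-hand sides below can be absorbed. The resulting bounds give 3
      norm d + norm l at most (12 c + 2 c + 8 c^3) norm s, hence at most 22 c^3 norm s; the last
      power of c comes from P and Q.\<close>
    show "22 * c^4 > 0" "1 / (10 * c^3) > 0" using c by auto
    fix \<epsilon> s d l \<rho> and A :: "real^'p^'p" and G' :: "real^'r^'p"
    assume \<epsilon>: "0 \<le> \<epsilon>" "\<epsilon> \<le> 1 / (10 * c^3)"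
      and eq: "s - A *v d + \<rho> + G' *v l = 0"
      and A: "norm (A *v d - H *v d) \<le> \<epsilon> * norm d" and \<rho>: "norm \<rho> \<le> \<epsilon> * norm d"
      and G': "norm (G' *v l - G *v l) \<le> \<epsilon> * norm l"
      and Gd: "norm (transpose G *v d) \<le> \<epsilon> * norm d"
    have \<epsilon>c3: "\<epsilon> * c^3 \<le> 1/10"
      using \<epsilon>(2) c by (simp add: field_simps)
    have \<epsilon>c2: "\<epsilon> * c^2 \<le> 1/10" and \<epsilon>c: "\<epsilon> * c \<le> 1/10"
      using \<epsilon>c3 pw mult_left_mono[OF pw(2) \<epsilon>(1)] mult_left_mono[OF pw(1) \<epsilon>(1)] by linarith+
    \<comment> \<open>All three perturbations are moved into \<open>e\<close>, so that the system
      has the exact coefficients H and G. The bound on \<open>e\<close> still involves the unknown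
      sizes of \<open>d\<close> and \<open>l\<close>.\<close>
    define e where "e = (H *v d - A *v d) + \<rho> + (G' *v l - G *v l)"
    have eq': "s - H *v d + G *v l + e = 0"
      using eq by (simp add: e_def algebra_simps)
    have e: "norm e \<le> \<epsilon> * (2 * norm d + norm l)"
      using norm_triangle_le[OF add_mono[OF norm_triangle_le[OF add_mono[OF
            A[unfolded norm_minus_commute[of "A *v d"]] \<rho>]] G']]
      by (simp add: e_def algebra_simps)
    have "P *v (s - H *v d + G *v l + e) = 0"
      by (simp add: eq')
    then have "P *v s - (P ** H) *v d + (P ** G) *v l + P *v e = 0"
      by (simp add: matrix_vector_right_distrib matrix_vector_mult_diff_distrib matrix_vector_mul_assoc)
    then have "d - P *v s = P *v e - Q *v (transpose G *v d)"
      unfolding PG PH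
      by (simp add: matrix_vector_mult_add_rdistrib matrix_vector_mul_assoc algebra_simps
          del: transpose_matrix_vector)
    then have "norm (d - P *v s) \<le> norm (P *v e) + norm (Q *v (transpose G *v d))"
      by (metis norm_triangle_ineq4)
    also have "\<dots> \<le> c * (\<epsilon> * (2 * norm d + norm l)) + c * (\<epsilon> * norm d)"
      using c by (intro add_mono order.trans[OF cP] order.trans[OF cQ] mult_left_mono e Gd) auto
    finally have dPs: "norm (d - P *v s) \<le> \<epsilon> * c * (3 * norm d + norm l)"
      by (simp add: algebra_simps)
    have "N *v (s - H *v d + G *v l + e) = 0"
      by (simp add: eq')
    then have "N *v s - N *v (H *v d) + (N ** G) *v l + N *v e = 0"
      by (simp add: matrix_vector_right_distrib matrix_vector_mult_diff_distrib matrix_vector_mul_assoc)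
    then have "l = N *v (H *v d) - N *v s - N *v e"
      unfolding N by (simp add: algebra_simps add_eq_0_iff)
    then have "norm l \<le> norm (N *v (H *v d)) + norm (N *v s) + norm (N *v e)"
      using norm_triangle_ineq4[of "N *v (H *v d) - N *v s" "N *v e"]
        norm_triangle_ineq4[of "N *v (H *v d)" "N *v s"] by simp
    also have "\<dots> \<le> c * (c * norm d) + c * norm s + c * (\<epsilon> * (2 * norm d + norm l))"
      using c by (intro add_mono order.trans[OF cN] mult_left_mono cH e) auto
    also have "\<dots> = c^2 * norm d + c * norm s + (\<epsilon> * c) * (2 * norm d + norm l)"
      by (simp add: algebra_simps power2_eq_square)
    also have "\<dots> \<le> c^2 * norm d + c * norm s + 1/10 * (2 * norm d + norm l)"
      using \<epsilon>c by (intro add_mono mult_right_mono) auto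
    finally have "norm l \<le> c^2 * norm d + c * norm s + 1/10 * (2 * norm d + norm l)" .
    \<comment> \<open>Here x stands for \<open>norm l\<close>, which also occurs on the right with
      factor 1/10 and is absorbed; the leftover multiple of \<open>norm d\<close> goes into
      \<open>c^2 * norm d\<close>.\<close>
    moreover have "x \<le> 2 * b + 2 * a" if "x \<le> a + b + (1/10) * (2 * y + x)" "y \<le> a" "z \<le> b"
      "0 \<le> y" "0 \<le> z" for a b x y z :: real
      using that by (simp add: field_simps)
    ultimately have "norm l \<le> 2 * (c * norm s) + 2 * (c^2 * norm d)"
      using mult_right_mono[OF pw(3) norm_ge_zero[of d]] mult_right_mono[OF c norm_ge_zero[of s]]
        norm_ge_zero[of d] norm_ge_zero[of s] unfolding mult_1 by blast
    then have l: "norm l \<le> 2 * c * norm s + 2 * c^2 * norm d"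
      by simp
    have Ps: "norm (P *v s) \<le> c * norm s" by (rule cP)
    \<comment> \<open>Inserting the bound on \<open>l\<close> estimates \<open>norm d\<close> by
      itself with factor 3/10 + 2/10 = 1/2, so it can be moved to the left.\<close>
    have "norm d \<le> norm (P *v s) + norm (d - P *v s)"
      by (metis add.commute diff_add_cancel norm_triangle_ineq)
    also have "\<dots> \<le> c * norm s + \<epsilon> * c * (3 * norm d + (2 * c * norm s + 2 * c^2 * norm d))"
      using c \<epsilon> by (intro add_mono Ps order.trans[OF dPs] mult_left_mono l) auto
    also have "\<dots> = c * norm s + 3 * ((\<epsilon> * c) * norm d) + 2 * ((\<epsilon> * c^2) * norm s)
        + 2 * ((\<epsilon> * c^3) * norm d)"
      by (simp add: algebra_simps power2_eq_square power3_eq_cube)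
    also have "\<dots> \<le> c * norm s + 3 * (1/10 * norm d) + 2 * (1/10 * norm s) + 2 * (1/10 * norm d)"
      using \<epsilon>c \<epsilon>c2 \<epsilon>c3 by (intro add_mono mult_left_mono mult_right_mono) auto
    finally have "norm d \<le> c * norm s + 3 * (1/10 * norm d) + 2 * (1/10 * norm s) + 2 * (1/10 * norm d)" .
    moreover have "x \<le> 4 * b"
      if "x \<le> b + 3 * (1/10 * x) + 2 * (1/10 * z) + 2 * (1/10 * x)" "z \<le> b" "0 \<le> z" for b x z :: real
      using that by simp
    ultimately have "norm d \<le> 4 * (c * norm s)"
      using mult_right_mono[OF c norm_ge_zero[of s]] norm_ge_zero[of s] unfolding mult_1 by blast
    then have d: "norm d \<le> 4 * c * norm s"
      by simp
    have "2 * c^2 * norm d \<le> 2 * c^2 * (4 * c * norm s)"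
      by (intro mult_left_mono d) auto
    also have "\<dots> = 8 * c^3 * norm s"
      by (simp add: power2_eq_square power3_eq_cube)
    finally have "3 * norm d + norm l \<le> 22 * c^3 * norm s"
      using d l mult_right_mono[OF order.trans[OF pw(1) pw(2)] norm_ge_zero[of s]]
        mult_right_mono[OF c norm_ge_zero[of s]] norm_ge_zero[of s] by (simp add: algebra_simps)
    then have "\<epsilon> * c * (3 * norm d + norm l) \<le> \<epsilon> * c * (22 * c^3 * norm s)"
      using c \<epsilon> by (intro mult_left_mono) auto
    also have "\<dots> = 22 * c^4 * \<epsilon> * norm s"
      by (simp add: power_def algebra_simps numeral_eq_Suc)
    finally show "norm (d - P *v s) \<le> 22 * c^4 * \<epsilon> * norm s"
      using dPs by simp
  qed
qed

text \<open>This crude bound converts entrywise estimates, as the law of large numbers provides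
  them, into estimates on vectors. It is the origin of the thresholds
  \<open>\<epsilon> / (p * p)\<close> and \<open>\<epsilon> / (p * q)\<close> in the final
  proof.\<close>

lemma norm_matrix_vector_le_entries:
  fixes A :: "real^'n^'m"
  assumes "\<And>i j. \<bar>A $ i $ j\<bar> \<le> c"
  shows "norm (A *v x) \<le> real CARD('m) * real CARD('n) * c * norm x"
proof -
  have "norm (A *v x) \<le> (\<Sum>i\<in>UNIV. \<bar>(A *v x) $ i\<bar>)"
    by (rule norm_le_l1_cart)
  also have "\<dots> \<le> (\<Sum>i\<in>(UNIV :: 'm set). \<Sum>j\<in>(UNIV :: 'n set). c * norm x)"
  proof (rule sum_mono)
    fix i
    have "\<bar>(A *v x) $ i\<bar> \<le> (\<Sum>j\<in>UNIV. \<bar>A $ i $ j * x $ j\<bar>)"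
      unfolding matrix_vector_mult_def by simp
    also have "\<dots> \<le> (\<Sum>j\<in>(UNIV :: 'n set). c * norm x)"
      unfolding abs_mult
      by (intro sum_mono mult_mono assms component_le_norm_cart order.trans[OF abs_ge_zero assms]) auto
    finally show "\<bar>(A *v x) $ i\<bar> \<le> (\<Sum>j\<in>(UNIV :: 'n set). c * norm x)" .
  qed
  finally show ?thesis by simp
qed

section \<open>Second order expansion of the score\<close>

lemma frechet_derivative_eq_partials:
  fixes F :: "real^'p \<Rightarrow> real"
  assumes "F differentiable (at x)"
  shows "frechet_derivative F (at x) v = (\<Sum>i\<in>UNIV. partial i F x * v $ i)"
proof -
  interpret D: linear "frechet_derivative F (at x)"
    using assms by (rule linear_frechet_derivative)
  have "frechet_derivative F (at x) v = frechet_derivative F (at x) (\<Sum>i\<in>UNIV. (v $ i) *\<^sub>R axis i 1)"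
    by (simp add: basis_expansion[of v, unfolded scalar_mult_eq_scaleR])
  also have "\<dots> = (\<Sum>i\<in>UNIV. partial i F x * v $ i)"
    by (simp add: D.sum D.scale partial_def mult.commute)
  finally show ?thesis .
qed

text \<open>The ball contains the segment from \<open>a\<close> to \<open>a + v\<close>, so the
  one-variable mean value theorem applies along it.\<close>

lemma mean_value_partials:
  fixes F :: "real^'p \<Rightarrow> real"
  assumes diff: "\<And>x. x \<in> ball a r \<Longrightarrow> F differentiable (at x)" and v: "norm v < r"
  obtains \<xi> where "0 < \<xi>" "\<xi> < 1"
    "F (a + v) - F a = (\<Sum>i\<in>UNIV. partial i F (a + \<xi> *\<^sub>R v) * v $ i)"
proof -
  have in_ball: "a + t *\<^sub>R v \<in> ball a r" if "0 \<le> t" "t \<le> 1" for t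
  proof -
    have "t * norm v \<le> norm v" using that by (simp add: mult_left_le_one_le)
    then show ?thesis using that v by (simp add: dist_norm)
  qed
  have D: "((\<lambda>t. F (a + t *\<^sub>R v)) has_derivative
      (\<lambda>h. frechet_derivative F (at (a + t *\<^sub>R v)) (h *\<^sub>R v))) (at t within {0..1})"
    if "0 \<le> t" "t \<le> 1" for t
  proof (rule has_derivative_compose[where f = "\<lambda>t. a + t *\<^sub>R v" and g = F])
    show "((\<lambda>t. a + t *\<^sub>R v) has_derivative (\<lambda>h. h *\<^sub>R v)) (at t within {0..1})"
      by (auto intro!: derivative_eq_intros)
    show "(F has_derivative frechet_derivative F (at (a + t *\<^sub>R v))) (at (a + t *\<^sub>R v))"
      using diff[OF in_ball[OF that]] by (simp add: frechet_derivative_works)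
  qed
  have "\<exists>\<xi>\<in>{0<..<1}. F (a + 1 *\<^sub>R v) - F (a + 0 *\<^sub>R v) =
      frechet_derivative F (at (a + \<xi> *\<^sub>R v)) ((1 - 0) *\<^sub>R v)"
    by (rule mvt_simple[where f = "\<lambda>t. F (a + t *\<^sub>R v)"]) (auto intro: D)
  then obtain \<xi> where \<xi>: "0 < \<xi>" "\<xi> < 1"
    "F (a + v) - F a = frechet_derivative F (at (a + \<xi> *\<^sub>R v)) v"
    by auto
  show thesis
    by (rule that[OF \<xi>(1,2)])
      (use \<xi> frechet_derivative_eq_partials[OF diff[OF in_ball[of \<xi>]]] in simp)
qed

lemma sum_abs_components_le:
  fixes v :: "real^'p"
  shows "(\<Sum>i\<in>UNIV. \<bar>v $ i\<bar>) \<le> real CARD('p) * norm v"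
  using sum_mono[of UNIV "\<lambda>i. \<bar>v $ i\<bar>" "\<lambda>_. norm v"] by (simp add: component_le_norm_cart)

text \<open>The mean value theorem is used twice: for \<open>F\<close> along \<open>v\<close>, and
  then for each partial derivative along the shortened step \<open>\<xi> *\<^sub>R v\<close>. This
  avoids Taylor's formula at the price of its factor 1/2. Later \<open>F\<close> is a component of
  the score, so \<open>b\<close> bounds third derivatives of the composite log-density.\<close>

lemma second_order_remainder:
  fixes F :: "real^'p \<Rightarrow> real"
  assumes F: "\<And>x. x \<in> ball a r \<Longrightarrow> F differentiable (at x)"
    and F': "\<And>x i. x \<in> ball a r \<Longrightarrow> partial i F differentiable (at x)"
    and b: "\<And>x i k. x \<in> ball a r \<Longrightarrow> \<bar>partial k (partial i F) x\<bar> \<le> b"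
    and v: "norm v < r"
  shows "\<bar>F (a + v) - F a - (\<Sum>i\<in>UNIV. partial i F a * v $ i)\<bar> \<le> b * (real CARD('p) * norm v)\<^sup>2"
proof -
  let ?s = "\<Sum>i\<in>UNIV. \<bar>v $ i\<bar>"
  have "0 < r" using v norm_ge_zero[of v] by linarith
  then have b0: "0 \<le> b" using b[of a undefined undefined] by simp
  obtain \<xi> where \<xi>: "0 < \<xi>" "\<xi> < 1"
    "F (a + v) - F a = (\<Sum>i\<in>UNIV. partial i F (a + \<xi> *\<^sub>R v) * v $ i)"
    using mean_value_partials[of a r F v] F v by blast
  have \<xi>v: "norm (\<xi> *\<^sub>R v) < r"
    using \<xi> v mult_left_le_one_le[of "norm v" \<xi>] by simp
  have diff: "\<bar>partial i F (a + \<xi> *\<^sub>R v) - partial i F a\<bar> \<le> b * ?s" for i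
  proof -
    obtain \<eta> where \<eta>: "0 < \<eta>" "\<eta> < 1" "partial i F (a + \<xi> *\<^sub>R v) - partial i F a =
        (\<Sum>k\<in>UNIV. partial k (partial i F) (a + \<eta> *\<^sub>R (\<xi> *\<^sub>R v)) * (\<xi> *\<^sub>R v) $ k)"
      using mean_value_partials[of a r "partial i F" "\<xi> *\<^sub>R v"] F' \<xi>v by blast
    have in_ball: "a + \<eta> *\<^sub>R (\<xi> *\<^sub>R v) \<in> ball a r"
      using \<eta> \<xi>v mult_left_le_one_le[of "norm (\<xi> *\<^sub>R v)" \<eta>] by (simp add: dist_norm abs_mult mult.assoc)
    have "\<bar>partial i F (a + \<xi> *\<^sub>R v) - partial i F a\<bar> \<le>
        (\<Sum>k\<in>UNIV. \<bar>partial k (partial i F) (a + \<eta> *\<^sub>R (\<xi> *\<^sub>R v)) * (\<xi> *\<^sub>R v) $ k\<bar>)"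
      unfolding \<eta>(3) by (rule sum_abs)
    also have "\<dots> \<le> (\<Sum>k\<in>UNIV. b * \<bar>v $ k\<bar>)"
      unfolding abs_mult using b[OF in_ball] \<xi> b0
      by (intro sum_mono mult_mono) (auto simp: abs_mult mult_left_le_one_le)
    finally show ?thesis by (simp add: sum_distrib_left)
  qed
  have "F (a + v) - F a - (\<Sum>i\<in>UNIV. partial i F a * v $ i) =
      (\<Sum>i\<in>UNIV. (partial i F (a + \<xi> *\<^sub>R v) - partial i F a) * v $ i)"
    by (simp add: \<xi>(3) sum_subtractf algebra_simps)
  also have "\<bar>\<dots>\<bar> \<le> (\<Sum>i\<in>UNIV. \<bar>(partial i F (a + \<xi> *\<^sub>R v) - partial i F a) * v $ i\<bar>)"
    by (rule sum_abs)
  also have "\<dots> \<le> (\<Sum>i\<in>UNIV. b * ?s * \<bar>v $ i\<bar>)"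
    unfolding abs_mult by (intro sum_mono mult_right_mono diff) auto
  also have "\<dots> = b * ?s\<^sup>2"
    by (simp only: sum_distrib_left[symmetric] power2_eq_square mult.assoc)
  also have "\<dots> \<le> b * (real CARD('p) * norm v)\<^sup>2"
    using b0 by (intro mult_left_mono power_mono sum_abs_components_le sum_nonneg) auto
  finally show ?thesis .
qed

text \<open>\<open>A\<close> is the empirical counterpart of the sensitivity matrix, with rows
  indexed by the components of the score. In the cube of the dimension, two factors come from the
  remainder of each component and one from summing the components.\<close>

lemma score_sum_expansion:
  fixes cl :: "real^'p \<Rightarrow> 'y \<Rightarrow> real"
  assumes cd: "\<And>k. k < n \<Longrightarrow> continuously_differentiable 3 U (\<lambda>t. cl t (ys k))"
    and b: "\<And>k x i j l. k < n \<Longrightarrow> x \<in> U \<Longrightarrow>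
      \<bar>partial i (partial j (partial l (\<lambda>t. cl t (ys k)))) x\<bar> \<le> B (ys k)"
    and U: "ball a r \<subseteq> U" and v: "norm v < r" and n: "0 < n"
    and A: "A = (\<chi> j i. - ((\<Sum>k<n. partial i (\<lambda>t. score cl t (ys k) $ j) a) / real n))"
  shows "norm ((\<Sum>k<n. score cl (a + v) (ys k)) - (\<Sum>k<n. score cl a (ys k)) + real n *\<^sub>R (A *v v))
    \<le> real CARD('p) ^ 3 * (\<Sum>k<n. B (ys k)) * (norm v)\<^sup>2" (is "norm ?R \<le> _")
proof -
  have score: "(\<lambda>t. score cl t y $ j) = partial j (\<lambda>t. cl t y)" for y j
    by (simp add: score_def fun_eq_iff)
  have R: "?R $ j = (\<Sum>k<n. score cl (a + v) (ys k) $ j - score cl a (ys k) $ j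
      - (\<Sum>i\<in>UNIV. partial i (partial j (\<lambda>t. cl t (ys k))) a * v $ i))" for j
  proof -
    have "real n * (A *v v) $ j = (\<Sum>i\<in>UNIV. - (\<Sum>k<n. partial i (partial j (\<lambda>t. cl t (ys k))) a) * v $ i)"
      using n by (simp add: A matrix_vector_mult_def score sum_distrib_left)
    also have "\<dots> = - (\<Sum>k<n. \<Sum>i\<in>UNIV. partial i (partial j (\<lambda>t. cl t (ys k))) a * v $ i)"
      by (subst sum.swap) (simp add: sum_negf sum_distrib_right)
    finally show ?thesis
      by (simp add: sum_subtractf)
  qed
  have "\<bar>?R $ j\<bar> \<le> (\<Sum>k<n. B (ys k)) * (real CARD('p) * norm v)\<^sup>2" for j
  proof -
    have "\<bar>score cl (a + v) (ys k) $ j - score cl a (ys k) $ j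
      - (\<Sum>i\<in>UNIV. partial i (partial j (\<lambda>t. cl t (ys k))) a * v $ i)\<bar>
      \<le> B (ys k) * (real CARD('p) * norm v)\<^sup>2" if "k < n" for k
      unfolding fun_cong[OF score]
      by (rule second_order_remainder[where r = r])
        (use cd[OF that] b[OF that] U v in \<open>auto simp: numeral_3_eq_3\<close>)
    then have "(\<Sum>k<n. \<bar>score cl (a + v) (ys k) $ j - score cl a (ys k) $ j
      - (\<Sum>i\<in>UNIV. partial i (partial j (\<lambda>t. cl t (ys k))) a * v $ i)\<bar>)
      \<le> (\<Sum>k<n. B (ys k) * (real CARD('p) * norm v)\<^sup>2)"
      by (intro sum_mono) auto
    then show ?thesis
      unfolding R sum_distrib_right by (rule order.trans[OF sum_abs])
  qed
  then have "(\<Sum>j\<in>UNIV. \<bar>?R $ j\<bar>) \<le> (\<Sum>j\<in>(UNIV :: 'p set). (\<Sum>k<n. B (ys k)) * (real CARD('p) * norm v)\<^sup>2)"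
    by (intro sum_mono) auto
  then have "norm ?R \<le> real CARD('p) * ((\<Sum>k<n. B (ys k)) * (real CARD('p) * norm v)\<^sup>2)"
    using norm_le_l1_cart[of ?R] by simp
  also have "\<dots> = real CARD('p) ^ 3 * (\<Sum>k<n. B (ys k)) * (norm v)\<^sup>2"
    by (simp add: power2_eq_square power3_eq_cube)
  finally show ?thesis .
qed

lemma transpose_constraint_matrix:
  assumes "g differentiable (at \<theta>)"
  shows "transpose (constraint_matrix g \<theta>) *v v = frechet_derivative g (at \<theta>) v"
  using matrix_works[OF linear_frechet_derivative[OF assms, folded linear_matrix_vector_mul_eq], of v]
  by (simp add: constraint_matrix_def del: transpose_matrix_vector)

section \<open>Weak law of large numbers\<close>

lemma borel_measurable_vec_lambda [measurable (raw)]: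
  fixes f :: "'a \<Rightarrow> 'n::finite \<Rightarrow> real"
  assumes "\<And>i. (\<lambda>x. f x i) \<in> borel_measurable M"
  shows "(\<lambda>x. \<chi> i. f x i) \<in> borel_measurable M"
  by (subst borel_measurable_euclidean_space) (use assms in \<open>auto simp: Basis_vec_def inner_axis\<close>)

context prob_space begin

text \<open>Independence and zero means make the cross terms of the squared sum vanish. The result
  serves the truncated variables of the weak law and, later, the tightness of the normalized
  score.\<close>

lemma
  fixes X :: "nat \<Rightarrow> 'a \<Rightarrow> real"
  assumes indep: "indep_vars (\<lambda>_. borel) X UNIV"
    and sq: "\<And>i. integrable M (\<lambda>\<omega>. (X i \<omega>)\<^sup>2)"
    and mean: "\<And>i. expectation (X i) = 0"
    and var: "\<And>i. expectation (\<lambda>\<omega>. (X i \<omega>)\<^sup>2) = v"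
  shows integrable_square_indep_sum: "integrable M (\<lambda>\<omega>. (\<Sum>i<n. X i \<omega>)\<^sup>2)"
    and second_moment_indep_sum: "expectation (\<lambda>\<omega>. (\<Sum>i<n. X i \<omega>)\<^sup>2) = real n * v"
proof -
  have rv [measurable]: "random_variable borel (X i)" for i
    using indep by (simp add: indep_vars_def2)
  have int: "integrable M (X i)" for i
    by (rule square_integrable_imp_integrable[OF rv sq])
  have *: "integrable M (\<lambda>\<omega>. X i \<omega> * X j \<omega>) \<and>
      expectation (\<lambda>\<omega>. X i \<omega> * X j \<omega>) = (if i = j then v else 0)" for i j
  proof (cases "i = j")
    case True
    then show ?thesis using sq[of i] var[of i] by (simp add: power2_eq_square)
  next
    case False
    have "indep_vars (\<lambda>_. borel) X {i, j}"
      by (rule indep_vars_subset[OF indep]) auto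
    then have "integrable M (\<lambda>\<omega>. \<Prod>k\<in>{i, j}. X k \<omega>)"
        "expectation (\<lambda>\<omega>. \<Prod>k\<in>{i, j}. X k \<omega>) = (\<Prod>k\<in>{i, j}. expectation (X k))"
      using int by (auto intro!: indep_vars_integrable indep_vars_lebesgue_integral)
    then show ?thesis using False mean by simp
  qed
  have eq: "(\<lambda>\<omega>. (\<Sum>i<n. X i \<omega>)\<^sup>2) = (\<lambda>\<omega>. \<Sum>i<n. \<Sum>j<n. X i \<omega> * X j \<omega>)"
    by (simp add: power2_eq_square sum_product)
  show "integrable M (\<lambda>\<omega>. (\<Sum>i<n. X i \<omega>)\<^sup>2)"
    unfolding eq using * by (intro Bochner_Integration.integrable_sum) auto
  have "expectation (\<lambda>\<omega>. (\<Sum>i<n. X i \<omega>)\<^sup>2) = (\<Sum>i<n. \<Sum>j<n. expectation (\<lambda>\<omega>. X i \<omega> * X j \<omega>))"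
    unfolding eq using * by (subst Bochner_Integration.integral_sum
      | intro sum.cong refl Bochner_Integration.integrable_sum | simp)+
  also have "\<dots> = (\<Sum>i<n. \<Sum>j<n. if i = j then v else 0)"
    using * by simp
  also have "\<dots> = real n * v"
    by simp
  finally show "expectation (\<lambda>\<omega>. (\<Sum>i<n. X i \<omega>)\<^sup>2) = real n * v" .
qed

text \<open>The pointwise inequality behind this distinguishes |x| below and above \<eta>. The free
  parameter \<eta> replaces the square root of the Cauchy-Schwarz inequality.\<close>

lemma abs_expectation_le_second_moment:
  fixes X :: "'a \<Rightarrow> real"
  assumes "random_variable borel X" "integrable M (\<lambda>\<omega>. (X \<omega>)\<^sup>2)" "\<eta> > 0"
  shows "expectation (\<lambda>\<omega>. \<bar>X \<omega>\<bar>) \<le> \<eta> + expectation (\<lambda>\<omega>. (X \<omega>)\<^sup>2) / \<eta>"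
proof -
  have le: "\<bar>x\<bar> \<le> \<eta> + x\<^sup>2 / \<eta>" for x :: real
  proof (cases "\<bar>x\<bar> \<le> \<eta>")
    case True
    moreover have "0 \<le> x\<^sup>2 / \<eta>" using assms(3) by simp
    ultimately show ?thesis by linarith
  next
    case False
    then have "\<bar>x\<bar> * \<eta> \<le> \<bar>x\<bar> * \<bar>x\<bar>"
      using assms(3) by (intro mult_left_mono) auto
    then have "\<bar>x\<bar> \<le> x\<^sup>2 / \<eta>"
      using assms(3) by (simp add: field_simps power2_eq_square)
    then show ?thesis using assms(3) by linarith
  qed
  have "integrable M X"
    by (rule square_integrable_imp_integrable[OF assms(1,2)])
  then have "expectation (\<lambda>\<omega>. \<bar>X \<omega>\<bar>) \<le> expectation (\<lambda>\<omega>. \<eta> + (X \<omega>)\<^sup>2 / \<eta>)"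
    using assms(2) le by (intro integral_mono) auto
  also have "\<dots> = \<eta> + expectation (\<lambda>\<omega>. (X \<omega>)\<^sup>2) / \<eta>"
    using assms(2) by (simp add: prob_space)
  finally show ?thesis .
qed

text \<open>Only first moments are assumed, so the summands are truncated before second moments are used.\<close>

lemma weak_law_L1:
  fixes X :: "nat \<Rightarrow> 'a \<Rightarrow> real"
  assumes indep: "indep_vars (\<lambda>_. borel) X UNIV"
    and law: "\<And>i. distr M borel (X i) = \<mu>"
    and int: "integrable M (X 0)"
  shows "(\<lambda>n. expectation (\<lambda>\<omega>. \<bar>(\<Sum>i<n. X i \<omega>) / real n - expectation (X 0)\<bar>)) \<longlonglongrightarrow> 0"
proof -
  have rv [measurable]: "random_variable borel (X i)" for i
    using indep by (simp add: indep_vars_def2)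
  have same: "expectation (\<lambda>\<omega>. h (X i \<omega>)) = expectation (\<lambda>\<omega>. h (X 0 \<omega>))"
    if [measurable]: "h \<in> borel_measurable borel" for h :: "real \<Rightarrow> real" and i
    using integral_distr[OF rv that, of i] integral_distr[OF rv that, of 0] by (simp add: law)
  have int': "integrable M (X i)" for i
    using integrable_distr_eq[OF rv, of "\<lambda>x. x" i] integrable_distr_eq[OF rv, of "\<lambda>x. x" 0] int
    by (simp add: law)
  define T where "T c x = (if \<bar>x\<bar> \<le> c then x else 0)" for c x :: real
  have T [measurable]: "T c \<in> borel_measurable borel" for c
    unfolding T_def by measurable
  have T_le: "\<bar>T c x\<bar> \<le> \<bar>c\<bar>" "\<bar>T c x\<bar> \<le> \<bar>x\<bar>" "\<bar>x - T c x\<bar> \<le> \<bar>x\<bar>" for c x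
    by (auto simp: T_def)
  define m where "m c = expectation (\<lambda>\<omega>. T c (X 0 \<omega>))" for c
  \<comment> \<open>The error of truncation in mean. It does not depend on n, and it tends to 0
    because for each \<omega> the truncation is eventually inactive while
    \<open>\<bar>X 0 \<omega>\<bar>\<close> dominates.\<close>
  define \<delta> where "\<delta> c = expectation (\<lambda>\<omega>. \<bar>X 0 \<omega> - T c (X 0 \<omega>)\<bar>)" for c
  have intT: "integrable M (\<lambda>\<omega>. T c (X i \<omega>))" for c i
    by (rule Bochner_Integration.integrable_bound[OF int'[of i]]) (use T_le in auto)
  have "(\<lambda>k. \<delta> (real k)) \<longlonglongrightarrow> expectation (\<lambda>\<omega>. 0)"
    unfolding \<delta>_def
  proof (rule integral_dominated_convergence[where w = "\<lambda>\<omega>. \<bar>X 0 \<omega>\<bar>"])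
    show "AE \<omega> in M. (\<lambda>k. \<bar>X 0 \<omega> - T (real k) (X 0 \<omega>)\<bar>) \<longlonglongrightarrow> 0"
    proof (rule AE_I2)
      fix \<omega>
      obtain N where N: "\<bar>X 0 \<omega>\<bar> \<le> real N"
        using real_arch_simple by blast
      show "(\<lambda>k. \<bar>X 0 \<omega> - T (real k) (X 0 \<omega>)\<bar>) \<longlonglongrightarrow> 0"
        by (rule tendsto_eventually)
          (use N in \<open>auto simp: T_def eventually_sequentially intro!: exI[of _ N]\<close>)
    qed
  qed (use int T_le in auto)
  then have \<delta>_lim: "(\<lambda>k. \<delta> (real k)) \<longlonglongrightarrow> 0" by simp
  show ?thesis
  proof (rule LIMSEQ_I)
    fix \<epsilon> :: real assume "\<epsilon> > 0"
    \<comment> \<open>The final bound has three terms. This choice makes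
      \<open>2 * \<delta> c\<close> smaller than \<epsilon>/4, the second is
      \<open>\<epsilon> / 4\<close> itself, and the variance term drops below \<epsilon>/4 for large
      n.\<close>
    then obtain k where k: "\<bar>\<delta> (real k)\<bar> < \<epsilon> / 8"
      using LIMSEQ_D[OF \<delta>_lim, of "\<epsilon> / 8"] by (auto simp: eventually_sequentially)
    define c where "c = real k"
    define Z where "Z i \<omega> = T c (X i \<omega>) - m c" for i \<omega>
    have Zrv [measurable]: "random_variable borel (Z i)" for i
      unfolding Z_def by measurable
    have m_le: "\<bar>m c\<bar> \<le> c"
    proof -
      have "\<bar>m c\<bar> \<le> expectation (\<lambda>\<omega>. \<bar>T c (X 0 \<omega>)\<bar>)"
        unfolding m_def by (rule integral_abs_bound)
      also have "\<dots> \<le> expectation (\<lambda>\<omega>. c)"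
        using T_le(1)[of c] by (intro integral_mono) (auto intro: intT simp: c_def)
      finally show ?thesis by (simp add: prob_space)
    qed
    have Zb: "\<bar>Z i \<omega>\<bar> \<le> 2 * c" for i \<omega>
      using T_le(1)[of c "X i \<omega>"] m_le by (auto simp: Z_def c_def)
    have Z2b: "(Z i \<omega>)\<^sup>2 \<le> (2 * c)\<^sup>2" for i \<omega>
      using Zb[of i \<omega>] abs_le_square_iff[of "Z i \<omega>" "2 * c"] by (simp add: c_def)
    have Zsq: "integrable M (\<lambda>\<omega>. (Z i \<omega>)\<^sup>2)" for i
      by (rule integrable_const_bound[where B = "(2 * c)\<^sup>2"]) (use Z2b in auto)
    have Zmean: "expectation (Z i) = 0" for i
      using same[of "T c" i] intT by (simp add: Z_def[abs_def] m_def prob_space)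
    define v where "v = expectation (\<lambda>\<omega>. (Z 0 \<omega>)\<^sup>2)"
    have Zvar: "expectation (\<lambda>\<omega>. (Z i \<omega>)\<^sup>2) = v" for i
      using same[of "\<lambda>x. (T c x - m c)\<^sup>2" i] by (simp add: v_def Z_def)
    have Zind: "indep_vars (\<lambda>_. borel) Z UNIV"
      unfolding Z_def by (rule indep_vars_compose2[OF indep]) simp
    note Z2 = integrable_square_indep_sum[OF Zind Zsq Zmean Zvar]
      second_moment_indep_sum[OF Zind Zsq Zmean Zvar]
    have v0: "0 \<le> v" by (simp add: v_def)
    \<comment> \<open>\<open>\<delta> c\<close> is counted twice: once for the average of the
      discarded parts, once for the shift of the mean caused by truncation.\<close>
    have main: "expectation (\<lambda>\<omega>. \<bar>(\<Sum>i<n. X i \<omega>) / real n - expectation (X 0)\<bar>)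
        \<le> \<epsilon> / 4 + (v / real n) / (\<epsilon> / 4) + 2 * \<delta> c" if n: "n > 0" for n
    proof -
      let ?a = "\<lambda>\<omega>. \<bar>(\<Sum>i<n. Z i \<omega>) / real n\<bar>"
      let ?b = "\<lambda>\<omega>. (\<Sum>i<n. \<bar>X i \<omega> - T c (X i \<omega>)\<bar>) / real n"
      have intd: "integrable M (\<lambda>\<omega>. \<bar>X i \<omega> - T c (X i \<omega>)\<bar>)" for i
        by (intro integrable_abs Bochner_Integration.integrable_diff int' intT)
      have intZ: "integrable M (\<lambda>\<omega>. (\<Sum>i<n. Z i \<omega>) / real n)"
        by (intro integrable_divide Bochner_Integration.integrable_sum)
          (auto simp: Z_def intro!: intT)
      have md: "\<bar>expectation (X 0) - m c\<bar> \<le> \<delta> c"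
        using integral_abs_bound[of M "\<lambda>\<omega>. X 0 \<omega> - T c (X 0 \<omega>)"] int intT
        by (simp add: m_def \<delta>_def)
      have pw: "\<bar>(\<Sum>i<n. X i \<omega>) / real n - expectation (X 0)\<bar> \<le> ?a \<omega> + ?b \<omega> + \<delta> c" for \<omega>
      proof -
        have "(\<Sum>i<n. X i \<omega>) / real n - expectation (X 0) =
            (\<Sum>i<n. Z i \<omega>) / real n + (\<Sum>i<n. X i \<omega> - T c (X i \<omega>)) / real n - (expectation (X 0) - m c)"
          using n by (simp add: Z_def sum_subtractf field_simps)
        moreover have "\<bar>(\<Sum>i<n. X i \<omega> - T c (X i \<omega>)) / real n\<bar> \<le> ?b \<omega>"
          by (simp add: divide_right_mono sum_abs)
        ultimately show ?thesis using md by linarith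
      qed
      have "expectation (\<lambda>\<omega>. \<bar>(\<Sum>i<n. X i \<omega>) / real n - expectation (X 0)\<bar>)
          \<le> expectation (\<lambda>\<omega>. ?a \<omega> + ?b \<omega> + \<delta> c)"
      proof (rule integral_mono)
        show "integrable M (\<lambda>\<omega>. \<bar>(\<Sum>i<n. X i \<omega>) / real n - expectation (X 0)\<bar>)"
          using int' by simp
        show "integrable M (\<lambda>\<omega>. ?a \<omega> + ?b \<omega> + \<delta> c)"
          using integrable_abs[OF intZ] intd by (intro Bochner_Integration.integrable_add) auto
      qed (rule pw)
      also have "\<dots> = expectation ?a + expectation ?b + \<delta> c"
      proof -
        have ia: "integrable M ?a" using intZ by (rule integrable_abs)
        have ib: "integrable M ?b" using intd by simp
        show ?thesis
          using Bochner_Integration.integral_add[OF ia ib]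
            Bochner_Integration.integral_add[OF Bochner_Integration.integrable_add[OF ia ib]
              integrable_const[of "\<delta> c"]]
          by (simp add: prob_space)
      qed
      also have "expectation ?b = \<delta> c"
      proof -
        have "expectation (\<lambda>\<omega>. \<bar>X i \<omega> - T c (X i \<omega>)\<bar>) = \<delta> c" for i
          using same[of "\<lambda>x. \<bar>x - T c x\<bar>" i] by (simp add: \<delta>_def)
        note \<delta>i = this
        have "expectation ?b = (\<Sum>i<n. expectation (\<lambda>\<omega>. \<bar>X i \<omega> - T c (X i \<omega>)\<bar>)) / real n"
          using intd by simp
        also have "\<dots> = (\<Sum>i<n. \<delta> c) / real n"
          by (simp only: \<delta>i)
        finally show ?thesis using n by simp
      qed
      also have "expectation ?a \<le> \<epsilon> / 4 + expectation (\<lambda>\<omega>. ((\<Sum>i<n. Z i \<omega>) / real n)\<^sup>2) / (\<epsilon> / 4)"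
        using Z2(1)[of n] \<open>\<epsilon> > 0\<close>
        by (intro abs_expectation_le_second_moment) (auto simp: power_divide)
      also have "expectation (\<lambda>\<omega>. ((\<Sum>i<n. Z i \<omega>) / real n)\<^sup>2) = v / real n"
        using Z2(2)[of n] n by (simp add: power_divide power2_eq_square)
      finally show ?thesis by simp
    qed
    have "(\<lambda>n. (v / real n) / (\<epsilon> / 4)) \<longlonglongrightarrow> 0 / (\<epsilon> / 4)"
      using \<open>\<epsilon> > 0\<close> by (intro tendsto_divide lim_const_over_n tendsto_const) auto
    then have "eventually (\<lambda>n. (v / real n) / (\<epsilon> / 4) < \<epsilon> / 4) sequentially"
      using \<open>\<epsilon> > 0\<close> by (intro order_tendstoD) auto
    then obtain N where N: "\<And>n. n \<ge> N \<Longrightarrow> (v / real n) / (\<epsilon> / 4) < \<epsilon> / 4"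
      by (auto simp: eventually_sequentially)
    show "\<exists>N. \<forall>n\<ge>N. norm (expectation (\<lambda>\<omega>. \<bar>(\<Sum>i<n. X i \<omega>) / real n - expectation (X 0)\<bar>) - 0) < \<epsilon>"
    proof (intro exI allI impI)
      \<comment> \<open>\<open>Suc N\<close> instead of \<open>N\<close> excludes n = 0, for which
        \<open>main\<close> does not apply.\<close>
      fix n assume "Suc N \<le> n"
      then have "n > 0" "n \<ge> N" by auto
      with main[of n] N[of n] k \<open>\<epsilon> > 0\<close>
      have "expectation (\<lambda>\<omega>. \<bar>(\<Sum>i<n. X i \<omega>) / real n - expectation (X 0)\<bar>) < \<epsilon>"
        by (simp add: c_def)
      then show "norm (expectation (\<lambda>\<omega>. \<bar>(\<Sum>i<n. X i \<omega>) / real n - expectation (X 0)\<bar>) - 0) < \<epsilon>"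
        by simp
    qed
  qed
qed

end

section \<open>Events of probability tending to one\<close>

context prob_space begin

text \<open>The predicates need not define measurable sets, so these rules manipulate measurable
  events on which the predicates hold.\<close>

lemma with_probability_tending_to_one_mono:
  assumes "with_probability_tending_to_one M \<Phi>"
    and "\<And>n \<omega>. 0 < n \<Longrightarrow> \<omega> \<in> space M \<Longrightarrow> \<Phi> n \<omega> \<Longrightarrow> \<Psi> n \<omega>"
  shows "with_probability_tending_to_one M \<Psi>"
proof -
  obtain E where E: "\<And>n. E n \<in> sets M" "\<And>n \<omega>. \<omega> \<in> E n \<Longrightarrow> \<Phi> n \<omega>" "(\<lambda>n. prob (E n)) \<longlonglongrightarrow> 1"
    using assms(1) unfolding with_probability_tending_to_one_def by blast
  \<comment> \<open>Emptying the event for n = 0 grants the premise \<open>0 < n\<close> and leaves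
    the limit unchanged.\<close>
  define E' where "E' n = (if n = 0 then {} else E n)" for n
  have "(\<lambda>n. prob (E' n)) \<longlonglongrightarrow> 1"
    by (rule Lim_transform_eventually[OF E(3)])
      (auto simp: E'_def eventually_sequentially intro!: exI[of _ 1])
  moreover have "E' n \<in> sets M" for n using E(1) by (simp add: E'_def)
  moreover have "\<Psi> n \<omega>" if "\<omega> \<in> E' n" for n \<omega>
  proof -
    have "0 < n" "\<omega> \<in> E n"
      using that by (auto simp: E'_def split: if_splits)
    then show ?thesis
      using assms(2) E(2) sets.sets_into_space[OF E(1)[of n]] by blast
  qed
  ultimately show ?thesis unfolding with_probability_tending_to_one_def by blast
qed

lemma with_probability_tending_to_one_conj:
  assumes "with_probability_tending_to_one M \<Phi>" "with_probability_tending_to_one M \<Psi>"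
  shows "with_probability_tending_to_one M (\<lambda>n \<omega>. \<Phi> n \<omega> \<and> \<Psi> n \<omega>)"
proof -
  obtain E where E: "\<And>n. E n \<in> sets M" "\<And>n \<omega>. \<omega> \<in> E n \<Longrightarrow> \<Phi> n \<omega>" "(\<lambda>n. prob (E n)) \<longlonglongrightarrow> 1"
    using assms(1) unfolding with_probability_tending_to_one_def by blast
  obtain F where F: "\<And>n. F n \<in> sets M" "\<And>n \<omega>. \<omega> \<in> F n \<Longrightarrow> \<Psi> n \<omega>" "(\<lambda>n. prob (F n)) \<longlonglongrightarrow> 1"
    using assms(2) unfolding with_probability_tending_to_one_def by blast
  have lower: "prob (E n) + prob (F n) - 1 \<le> prob (E n \<inter> F n)" for n
  proof -
    have "prob (E n) + prob (F n) = prob (E n \<union> F n) + prob (E n \<inter> F n)"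
      using measure_Un3[OF fmeasurableI fmeasurableI, of "E n" M "F n"] E(1) F(1)
      by (simp add: less_top[symmetric])
    then show ?thesis using prob_le_1[of "E n \<union> F n"] by linarith
  qed
  have "(\<lambda>n. prob (E n) + prob (F n) - 1) \<longlonglongrightarrow> 1 + 1 - 1"
    by (intro tendsto_intros E F)
  then have "(\<lambda>n. prob (E n) + prob (F n) - 1) \<longlonglongrightarrow> 1" by simp
  then have "(\<lambda>n. prob (E n \<inter> F n)) \<longlonglongrightarrow> 1"
    by (rule tendsto_sandwich[rotated 2, OF _ tendsto_const]) (use lower in auto)
  then show ?thesis
    unfolding with_probability_tending_to_one_def
    using E F by (intro exI[of _ "\<lambda>n. E n \<inter> F n"]) auto
qed

lemma with_probability_tending_to_one_AE:
  assumes "AE \<omega> in M. \<Phi> \<omega>"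
  shows "with_probability_tending_to_one M (\<lambda>n. \<Phi>)"
proof -
  obtain A where A: "{\<omega> \<in> space M. \<not> \<Phi> \<omega>} \<subseteq> A" "A \<in> null_sets M"
    using assms unfolding eventually_ae_filter by blast
  have "prob (space M - A) = 1"
    using A(2) prob_compl[of A] by (auto simp: null_setsD1 measure_def)
  then show ?thesis
    unfolding with_probability_tending_to_one_def
    using A by (intro exI[of _ "\<lambda>n. space M - A"]) auto
qed

lemma with_probability_tending_to_one_ball:
  assumes "finite I" "\<And>i. i \<in> I \<Longrightarrow> with_probability_tending_to_one M (\<Phi> i)"
  shows "with_probability_tending_to_one M (\<lambda>n \<omega>. \<forall>i\<in>I. \<Phi> i n \<omega>)"
  using assms
proof (induction I rule: finite_induct)
  case empty
  show ?case using with_probability_tending_to_one_AE[of "\<lambda>_. True"] by simp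
next
  case (insert i I)
  have "with_probability_tending_to_one M (\<lambda>n \<omega>. \<Phi> i n \<omega> \<and> (\<forall>i\<in>I. \<Phi> i n \<omega>))"
    by (intro with_probability_tending_to_one_conj insert) auto
  then show ?case by simp
qed

lemma with_probability_tending_to_one_dist_less:
  fixes X :: "nat \<Rightarrow> 'a \<Rightarrow> 'b::euclidean_space"
  assumes [measurable]: "\<And>n. random_variable borel (X n)"
    and "converges_in_probability M X c" "\<epsilon> > 0"
  shows "with_probability_tending_to_one M (\<lambda>n \<omega>. dist (X n \<omega>) c < \<epsilon>)"
proof -
  let ?A = "\<lambda>n. {\<omega> \<in> space M. \<epsilon> \<le> dist (X n \<omega>) c}"
  have A: "?A n \<in> sets M" for n by measurable
  have "(\<lambda>n. prob (?A n)) \<longlonglongrightarrow> 0"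
    using assms by (auto simp: converges_in_probability_def)
  then have "(\<lambda>n. 1 - prob (?A n)) \<longlonglongrightarrow> 1 - 0"
    by (intro tendsto_intros)
  then have "(\<lambda>n. prob (space M - ?A n)) \<longlonglongrightarrow> 1"
    using A by (simp add: prob_compl)
  then show ?thesis
    unfolding with_probability_tending_to_one_def
    using A by (intro exI[of _ "\<lambda>n. space M - ?A n"]) auto
qed

text \<open>Markov's inequality turns convergence in mean into convergence in probability. The form
  with a general \<open>\<phi>\<close> covers both the second derivatives of the composite
  log-density and the dominating function.\<close>

lemma converges_in_probability_average:
  fixes Y :: "nat \<Rightarrow> 'a \<Rightarrow> 'b::topological_space" and \<phi> :: "'b \<Rightarrow> real"
  assumes indep: "indep_vars (\<lambda>_. borel) Y UNIV"
    and law: "\<And>i. distr M borel (Y i) = L"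
    and int: "integrable L \<phi>"
  shows "converges_in_probability M (\<lambda>n \<omega>. (\<Sum>i<n. \<phi> (Y i \<omega>)) / real n) (integral\<^sup>L L \<phi>)"
proof -
  have Y [measurable]: "random_variable borel (Y i)" for i
    using indep by (simp add: indep_vars_def2)
  have \<phi> [measurable]: "\<phi> \<in> borel_measurable borel"
    using borel_measurable_integrable[OF int] law[of 0] by auto
  have int': "integrable M (\<lambda>\<omega>. \<phi> (Y i \<omega>))" for i
    using int integrable_distr_eq[OF Y \<phi>] by (simp add: law)
  have mean: "expectation (\<lambda>\<omega>. \<phi> (Y i \<omega>)) = integral\<^sup>L L \<phi>" for i
    using integral_distr[OF Y \<phi>] by (simp add: law)
  have law': "distr M borel (\<lambda>\<omega>. \<phi> (Y i \<omega>)) = distr L borel \<phi>" for i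
    using distr_distr[OF \<phi> Y, of i] law by (simp add: comp_def)
  let ?D = "\<lambda>n \<omega>. \<bar>(\<Sum>i<n. \<phi> (Y i \<omega>)) / real n - integral\<^sup>L L \<phi>\<bar>"
  have "indep_vars (\<lambda>_. borel) (\<lambda>i \<omega>. \<phi> (Y i \<omega>)) UNIV"
    by (rule indep_vars_compose2[OF indep]) simp
  from weak_law_L1[OF this law' int']
  have lim: "(\<lambda>n. expectation (?D n)) \<longlonglongrightarrow> 0"
    by (simp add: mean)
  show ?thesis
    unfolding converges_in_probability_def dist_real_def
  proof (intro allI impI)
    fix \<epsilon> :: real assume "\<epsilon> > 0"
    have "integrable M (?D n)" for n
      using int' by simp
    then have le: "prob {\<omega> \<in> space M. \<epsilon> \<le> ?D n \<omega>} \<le> expectation (?D n) / \<epsilon>" for n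
      using \<open>\<epsilon> > 0\<close> by (intro integral_Markov_inequality_measure[where A = "{}"]) auto
    have lim': "(\<lambda>n. expectation (?D n) / \<epsilon>) \<longlonglongrightarrow> 0"
      using tendsto_divide[OF lim tendsto_const[of \<epsilon>]] \<open>\<epsilon> > 0\<close> by simp
    show "(\<lambda>n. prob {\<omega> \<in> space M. \<epsilon> \<le> ?D n \<omega>}) \<longlonglongrightarrow> 0"
      by (rule tendsto_sandwich[OF _ _ tendsto_const lim'])
        (intro always_eventually allI measure_nonneg le)+
  qed
qed

end

section \<open>Convergence in law by trigonometric functions\<close>

text \<open>Inside the ball the error is at most \<delta>; outside only the bounds of
  \<open>h\<close> and \<open>q\<close> are available, weighted by the tail probability. Hence the
  bound of \<open>q\<close> must not grow with the radius.\<close>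

lemma (in prob_space) integral_approximation:
  fixes X :: "'a \<Rightarrow> 'b::euclidean_space" and h q :: "'b \<Rightarrow> real"
  assumes X: "random_variable borel X"
    and h: "continuous_on UNIV h" "\<And>x. \<bar>h x\<bar> \<le> m"
    and q: "continuous_on UNIV q" "\<And>x. \<bar>q x\<bar> \<le> m'"
    and near: "\<And>x. norm x \<le> R \<Longrightarrow> \<bar>h x - q x\<bar> \<le> \<delta>" and "0 \<le> \<delta>"
    and tail: "prob {\<omega> \<in> space M. R < norm (X \<omega>)} \<le> \<epsilon>"
  shows "\<bar>expectation (\<lambda>\<omega>. h (X \<omega>)) - expectation (\<lambda>\<omega>. q (X \<omega>))\<bar> \<le> \<delta> + (m + m') * \<epsilon>"
proof -
  note [measurable] = X borel_measurable_continuous_onI[OF h(1)] borel_measurable_continuous_onI[OF q(1)]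
  have hi: "integrable M (\<lambda>\<omega>. h (X \<omega>))"
    by (rule integrable_const_bound[where B = m]) (use h in auto)
  have qi: "integrable M (\<lambda>\<omega>. q (X \<omega>))"
    by (rule integrable_const_bound[where B = m']) (use q in auto)
  have mm: "0 \<le> m + m'"
    using h(2)[of undefined] q(2)[of undefined] by linarith
  define A where "A = {\<omega> \<in> space M. R < norm (X \<omega>)}"
  have A: "A \<in> sets M" unfolding A_def by measurable
  have iA: "integrable M (\<lambda>\<omega>. \<delta> + (m + m') * indicator A \<omega>)"
    using A by (intro Bochner_Integration.integrable_add integrable_mult_right
        integrable_real_indicator) (auto simp: less_top[symmetric])
  have le: "\<bar>h (X \<omega>) - q (X \<omega>)\<bar> \<le> \<delta> + (m + m') * indicator A \<omega>" if "\<omega> \<in> space M" for \<omega>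
  proof (cases "R < norm (X \<omega>)")
    case True
    then show ?thesis
      using h(2)[of "X \<omega>"] q(2)[of "X \<omega>"] \<open>0 \<le> \<delta>\<close> that by (simp add: A_def)
  next
    case False
    then show ?thesis using near[of "X \<omega>"] by (simp add: A_def)
  qed
  have "\<bar>expectation (\<lambda>\<omega>. h (X \<omega>)) - expectation (\<lambda>\<omega>. q (X \<omega>))\<bar>
      = \<bar>expectation (\<lambda>\<omega>. h (X \<omega>) - q (X \<omega>))\<bar>"
    using hi qi by simp
  also have "\<dots> \<le> expectation (\<lambda>\<omega>. \<bar>h (X \<omega>) - q (X \<omega>)\<bar>)"
    by (rule integral_abs_bound)
  also have "\<dots> \<le> expectation (\<lambda>\<omega>. \<delta> + (m + m') * indicator A \<omega>)"
    using hi qi le A by (intro integral_mono iA) auto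
  also have "\<dots> = \<delta> + (m + m') * prob A"
    using A by (simp add: prob_space less_top[symmetric])
  also have "\<dots> \<le> \<delta> + (m + m') * \<epsilon>"
    using mm tail unfolding A_def by (intro add_left_mono mult_left_mono)
  finally show ?thesis .
qed

section \<open>The algebra of trigonometric polynomials\<close>

text \<open>Products are deliberately not among the rules: convergence of expectations then passes
  from \<open>cos\<close> and \<open>sin\<close> to all members by linearity alone. Closure under
  products, needed for Stone-Weierstrass, is derived.\<close>

inductive_set trig_polynomials :: "('a::real_inner \<Rightarrow> real) set" where
  cos: "(\<lambda>x. cos (t \<bullet> x)) \<in> trig_polynomials"
| sin: "(\<lambda>x. sin (t \<bullet> x)) \<in> trig_polynomials"
| add: "p \<in> trig_polynomials \<Longrightarrow> q \<in> trig_polynomials \<Longrightarrow> (\<lambda>x. p x + q x) \<in> trig_polynomials"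
| scale: "p \<in> trig_polynomials \<Longrightarrow> (\<lambda>x. c * p x) \<in> trig_polynomials"

lemma trig_polynomials_const: "(\<lambda>x. c) \<in> trig_polynomials"
  using trig_polynomials.scale[OF trig_polynomials.cos[of 0], of c] by simp

lemma trig_polynomials_diff:
  assumes "p \<in> trig_polynomials" "q \<in> trig_polynomials"
  shows "(\<lambda>x. p x - q x) \<in> trig_polynomials"
  using trig_polynomials.add[OF assms(1) trig_polynomials.scale[OF assms(2), of "-1"]] by simp

text \<open>The product-to-sum formulas express a product with frequencies t and s through the
  frequencies t + s and t - s. Bilinearity does the rest, by an induction on each factor.\<close>

lemma trig_polynomials_mult:
  assumes "p \<in> trig_polynomials" "q \<in> trig_polynomials"
  shows "(\<lambda>x. p x * q x) \<in> trig_polynomials"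
  using assms(1)
proof induction
  case (cos t)
  show ?case using assms(2)
  proof induction
    case (cos s)
    have "(\<lambda>x. cos (t \<bullet> x) * cos (s \<bullet> x)) =
        (\<lambda>x. (1/2) * (cos ((t - s) \<bullet> x) + cos ((t + s) \<bullet> x)))"
      by (simp add: cos_times_cos inner_left_distrib inner_diff_left)
    then show ?case
      by (simp only:) (intro trig_polynomials.intros)
  next
    case (sin s)
    have "(\<lambda>x. cos (t \<bullet> x) * sin (s \<bullet> x)) =
        (\<lambda>x. (1/2) * (sin ((t + s) \<bullet> x) - sin ((t - s) \<bullet> x)))"
      by (simp add: cos_times_sin inner_left_distrib inner_diff_left)
    then show ?case
      by (simp only:) (intro trig_polynomials.scale trig_polynomials_diff trig_polynomials.sin)
  next
    case (add p q)
    then show ?case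
      using trig_polynomials.add by (simp add: distrib_left)
  next
    case (scale p c)
    then show ?case
      using trig_polynomials.scale[of _ c] by (simp add: mult.left_commute)
  qed
next
  case (sin t)
  show ?case using assms(2)
  proof induction
    case (cos s)
    have "(\<lambda>x. sin (t \<bullet> x) * cos (s \<bullet> x)) =
        (\<lambda>x. (1/2) * (sin ((t + s) \<bullet> x) + sin ((t - s) \<bullet> x)))"
      by (simp add: sin_times_cos inner_left_distrib inner_diff_left)
    then show ?case
      by (simp only:) (intro trig_polynomials.intros)
  next
    case (sin s)
    have "(\<lambda>x. sin (t \<bullet> x) * sin (s \<bullet> x)) =
        (\<lambda>x. (1/2) * (cos ((t - s) \<bullet> x) - cos ((t + s) \<bullet> x)))"
      by (simp add: sin_times_sin inner_left_distrib inner_diff_left)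
    then show ?case
      by (simp only:) (intro trig_polynomials.scale trig_polynomials_diff trig_polynomials.cos)
  next
    case (add p q)
    then show ?case
      using trig_polynomials.add by (simp add: distrib_left)
  next
    case (scale p c)
    then show ?case
      using trig_polynomials.scale[of _ c] by (simp add: mult.left_commute)
  qed
next
  case (add p q)
  then show ?case
    using trig_polynomials.add by (simp add: distrib_right)
next
  case (scale p c)
  then show ?case
    using trig_polynomials.scale[of _ c] by (simp add: mult.assoc)
qed

lemma trig_polynomials_continuous:
  "p \<in> trig_polynomials \<Longrightarrow> continuous_on A p"
  by (induction rule: trig_polynomials.induct) (auto intro!: continuous_intros)

lemma trig_polynomials_bounded:
  assumes "p \<in> trig_polynomials"
  shows "\<exists>b. \<forall>x. \<bar>p x\<bar> \<le> b"
  using assms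
proof induction
  case (cos t)
  show ?case by (rule exI[of _ 1]) simp
next
  case (sin t)
  show ?case by (rule exI[of _ 1]) simp
next
  case (add p q)
  then obtain a b where "\<And>x. \<bar>p x\<bar> \<le> a" "\<And>x. \<bar>q x\<bar> \<le> b" by blast
  then have "\<bar>p x + q x\<bar> \<le> a + b" for x
    by (meson abs_triangle_ineq add_mono order_trans)
  then show ?case by blast
next
  case (scale p c)
  then obtain a where "\<And>x. \<bar>p x\<bar> \<le> a" by blast
  then have "\<bar>c * p x\<bar> \<le> \<bar>c\<bar> * a" for x
    by (simp add: abs_mult mult_left_mono)
  then show ?case by blast
qed

lemma trig_polynomials_compose_polynomial:
  assumes "real_polynomial_function (P :: real \<Rightarrow> real)" "q \<in> trig_polynomials"
  shows "(\<lambda>x. P (q x)) \<in> trig_polynomials"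
  using assms(1)
proof induction
  \<comment> \<open>On the real line a bounded linear map is multiplication by its value at
    1.\<close>
  case (linear f)
  then have "f y = f 1 * y" for y
    using linear_cmul[of f y 1] bounded_linear.linear[of f] by (simp add: mult.commute)
  then have "(\<lambda>x. f (q x)) = (\<lambda>x. f 1 * q x)" by blast
  then show ?case
    using trig_polynomials.scale[OF assms(2), of "f 1"] by (simp only:)
next
  case (const c)
  show ?case by (rule trig_polynomials_const)
next
  case (add f g)
  show ?case by (rule trig_polynomials.add[OF add.IH])
next
  case (mult f g)
  show ?case by (rule trig_polynomials_mult[OF mult.IH])
qed

lemma trig_polynomials_separate:
  fixes x y :: "'a::real_inner"
  assumes "x \<noteq> y"
  shows "\<exists>p\<in>trig_polynomials. p x \<noteq> p y"
proof (rule ccontr)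
  assume contr: "\<not> ?thesis"
  \<comment> \<open>The scaling makes the phases at \<open>x\<close> and \<open>y\<close> differ by
    exactly 1, which is not a multiple of 2 pi; agreement of both cosine and sine would force cos 1
    = 1.\<close>
  define t where "t = (x - y) /\<^sub>R ((x - y) \<bullet> (x - y))"
  have eq: "p x = p y" if "p \<in> trig_polynomials" for p
    using contr that by blast
  have "cos (t \<bullet> x) = cos (t \<bullet> y)" "sin (t \<bullet> x) = sin (t \<bullet> y)"
    by (rule eq[OF trig_polynomials.cos] eq[OF trig_polynomials.sin])+
  then have "cos (t \<bullet> x - t \<bullet> y) = (cos (t \<bullet> y))\<^sup>2 + (sin (t \<bullet> y))\<^sup>2"
    by (simp add: cos_diff power2_eq_square)
  then have "cos (t \<bullet> x - t \<bullet> y) = 1" by simp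
  moreover have "t \<bullet> x - t \<bullet> y = t \<bullet> (x - y)"
    by (simp add: inner_diff_right)
  moreover have "t \<bullet> (x - y) = 1"
    using assms by (simp add: t_def)
  moreover have "cos (1 :: real) < cos 0"
    using pi_gt3 by (intro cos_monotone_0_pi) auto
  ultimately show False by simp
qed

text \<open>The Stone--Weierstrass approximation of \<open>h\<close> on a ball may be large outside of it. Composing it
  with a polynomial approximation of the truncation to \<open>[-m, m]\<close> gives again a trigonometric
  polynomial, now with a bound that does not depend on the ball.\<close>

lemma trig_polynomials_bounded_approximation:
  fixes h :: "'a::euclidean_space \<Rightarrow> real"
  assumes h: "continuous_on UNIV h" "\<And>x. \<bar>h x\<bar> \<le> m" and \<epsilon>: "\<epsilon> > 0"
  obtains q where "q \<in> trig_polynomials" "\<And>x. \<bar>q x\<bar> \<le> m + \<epsilon>"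
    "\<And>x. norm x \<le> R \<Longrightarrow> \<bar>h x - q x\<bar> \<le> \<epsilon>"
proof -
  interpret function_ring_on "trig_polynomials :: ('a \<Rightarrow> real) set" "cball 0 R"
    by unfold_locales (auto intro: trig_polynomials.add trig_polynomials_mult
        trig_polynomials_const trig_polynomials_continuous trig_polynomials_separate)
  obtain p where p: "p \<in> trig_polynomials" "\<And>x. x \<in> cball 0 R \<Longrightarrow> \<bar>h x - p x\<bar> < \<epsilon> / 2"
    using Stone_Weierstrass_basic[OF continuous_on_subset[OF h(1) subset_UNIV], of "\<epsilon> / 2"] \<epsilon> by auto
  obtain b where b: "\<And>x. \<bar>p x\<bar> \<le> b"
    using trig_polynomials_bounded[OF p(1)] by blast
  define c where "c y = max (- m) (min m y)" for y
  \<comment> \<open>This interval contains the values of \<open>p\<close> on the whole space, not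
    only on the ball of radius \<open>R\<close>, so the bound on the composition will be
    global.\<close>
  have "continuous_on (cball 0 b) c"
    unfolding c_def by (intro continuous_intros)
  then obtain P where P: "real_polynomial_function P" "\<And>y. y \<in> cball 0 b \<Longrightarrow> \<bar>c y - P y\<bar> < \<epsilon> / 2"
    using Stone_Weierstrass_real_polynomial_function[OF compact_cball, of 0 b c "\<epsilon> / 2"] \<epsilon> by auto
  have m: "0 \<le> m" using h(2)[of undefined] by linarith
  have cP: "\<bar>c (p x) - P (p x)\<bar> < \<epsilon> / 2" for x
    using P(2)[of "p x"] b[of x] by simp
  show thesis
  proof
    show "(\<lambda>x. P (p x)) \<in> trig_polynomials"
      by (rule trig_polynomials_compose_polynomial[OF P(1) p(1)])
    show "\<bar>P (p x)\<bar> \<le> m + \<epsilon>" for x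
    proof -
      have "\<bar>c (p x)\<bar> \<le> m" using m by (auto simp: c_def)
      then show ?thesis using cP[of x] \<epsilon> by linarith
    qed
    show "\<bar>h x - P (p x)\<bar> \<le> \<epsilon>" if "norm x \<le> R" for x
    proof -
      \<comment> \<open>Truncation to [-m, m] fixes the value \<open>h x\<close> and does not
        increase distances.\<close>
      have "\<bar>h x - c (p x)\<bar> \<le> \<bar>h x - p x\<bar>"
        using h(2)[of x] by (auto simp: c_def max_def min_def)
      moreover have "\<bar>h x - p x\<bar> < \<epsilon> / 2"
        using p(2)[of x] that by simp
      ultimately show ?thesis using cP[of x] by linarith
    qed
  qed
qed

lemma (in prob_space) exists_tail_bound:
  fixes X :: "'a \<Rightarrow> 'b::euclidean_space"
  assumes [measurable]: "random_variable borel X" and "\<epsilon> > 0"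
  obtains R where "prob {\<omega> \<in> space M. R < norm (X \<omega>)} < \<epsilon>"
proof -
  let ?A = "\<lambda>k. {\<omega> \<in> space M. real k < norm (X \<omega>)}"
  have "(\<lambda>k. prob (?A k)) \<longlonglongrightarrow> prob (\<Inter>k. ?A k)"
    by (rule finite_Lim_measure_decseq) (auto simp: decseq_def)
  moreover have "(\<Inter>k. ?A k) = {}"
  proof -
    have "\<exists>k. \<not> real k < norm (X \<omega>)" for \<omega>
      using real_arch_simple[of "norm (X \<omega>)"] by (auto simp: not_less)
    then show ?thesis by auto
  qed
  ultimately have "(\<lambda>k. prob (?A k)) \<longlonglongrightarrow> 0" by simp
  then have "eventually (\<lambda>k. prob (?A k) < \<epsilon>) sequentially"
    using \<open>\<epsilon> > 0\<close> by (rule order_tendstoD)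
  then show thesis using that by (auto simp: eventually_sequentially)
qed

lemma (in prob_space) converges_in_law_by_trig_functions:
  fixes X :: "nat \<Rightarrow> 'a \<Rightarrow> 'b::euclidean_space" and N :: "'b measure"
  assumes X [measurable]: "\<And>n. random_variable borel (X n)"
    and N: "prob_space N" and sets_N: "sets N = sets borel"
    and cos: "\<And>t. (\<lambda>n. expectation (\<lambda>\<omega>. cos (t \<bullet> X n \<omega>))) \<longlonglongrightarrow> (\<integral>x. cos (t \<bullet> x) \<partial>N)"
    and sin: "\<And>t. (\<lambda>n. expectation (\<lambda>\<omega>. sin (t \<bullet> X n \<omega>))) \<longlonglongrightarrow> (\<integral>x. sin (t \<bullet> x) \<partial>N)"
    and tight: "\<And>\<epsilon>. \<epsilon> > 0 \<Longrightarrow> \<exists>R. \<forall>\<^sub>F n in sequentially. prob {\<omega> \<in> space M. R < norm (X n \<omega>)} \<le> \<epsilon>"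
  shows "converges_in_law M X N"
proof -
  interpret N: prob_space N by (rule N)
  have [measurable_cong]: "sets N = sets borel" by (rule sets_N)
  have meas: "q \<in> borel_measurable borel" if "q \<in> trig_polynomials" for q :: "'b \<Rightarrow> real"
    by (intro borel_measurable_continuous_onI trig_polynomials_continuous that)
  have intM: "integrable M (\<lambda>\<omega>. q (X n \<omega>))" if "q \<in> trig_polynomials" for q n
  proof -
    obtain b where b: "\<And>x. \<bar>q x\<bar> \<le> b" using trig_polynomials_bounded[OF \<open>q \<in> _\<close>] by blast
    note [measurable] = meas[OF that]
    show ?thesis by (rule integrable_const_bound[where B = b]) (use b in auto)
  qed
  have intN: "integrable N q" if "q \<in> trig_polynomials" for q
  proof -
    obtain b where b: "\<And>x. \<bar>q x\<bar> \<le> b" using trig_polynomials_bounded[OF \<open>q \<in> _\<close>] by blast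
    note [measurable] = meas[OF that]
    show ?thesis by (rule N.integrable_const_bound[where B = b]) (use b in auto)
  qed
  have trig: "(\<lambda>n. expectation (\<lambda>\<omega>. q (X n \<omega>))) \<longlonglongrightarrow> integral\<^sup>L N q" if "q \<in> trig_polynomials" for q
    using that
  proof induction
    case (add p q)
    then show ?case using tendsto_add[OF add.IH] intM intN by simp
  next
    case (scale p c)
    then show ?case using tendsto_mult_left[OF scale.IH, of c] intM intN by simp
  qed (rule cos sin)+
  show ?thesis
    unfolding converges_in_law_def
  proof (intro allI impI)
    fix h :: "'b \<Rightarrow> real"
    assume "continuous_on UNIV h \<and> bounded (range h)"
    then obtain m where h: "continuous_on UNIV h" and m: "\<And>x. \<bar>h x\<bar> \<le> m"
      by (auto simp: bounded_iff)
    have m0: "0 \<le> m" using m[of undefined] by linarith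
    show "(\<lambda>n. expectation (\<lambda>\<omega>. h (X n \<omega>))) \<longlonglongrightarrow> integral\<^sup>L N h"
    proof (rule tendstoI)
      fix e :: real assume "e > 0"
      \<comment> \<open>Replacing h by q costs at most
        \<open>\<epsilon> + (m + (m + \<epsilon>)) * \<epsilon>\<close> under the law of
        \<open>X n\<close> and again under \<open>N\<close>, each at most e/2 - \<epsilon>; the
        convergence for q costs less than \<epsilon>. The minimum with 1 serves to bound the square
        of \<epsilon> by \<epsilon>.\<close>
      define \<epsilon> where "\<epsilon> = min 1 (e / (4 * (m + 2)))"
      have \<epsilon>: "0 < \<epsilon>" "\<epsilon> \<le> 1" using \<open>e > 0\<close> m0 by (auto simp: \<epsilon>_def)
      have "\<epsilon> * (4 * (m + 2)) \<le> e / (4 * (m + 2)) * (4 * (m + 2))"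
        using m0 by (intro mult_right_mono) (auto simp: \<epsilon>_def)
      then have \<epsilon>e: "\<epsilon> * (4 * (m + 2)) \<le> e" using m0 by simp
      obtain R1 where R1: "\<forall>\<^sub>F n in sequentially. prob {\<omega> \<in> space M. R1 < norm (X n \<omega>)} \<le> \<epsilon>"
        using tight[OF \<epsilon>(1)] by blast
      obtain R2 where R2: "N.prob {x \<in> space N. R2 < norm x} < \<epsilon>"
        using N.exists_tail_bound[of "\<lambda>x. x" \<epsilon>] \<epsilon> by auto
      obtain q where q: "q \<in> trig_polynomials" "\<And>x. \<bar>q x\<bar> \<le> m + \<epsilon>"
        "\<And>x. norm x \<le> max R1 R2 \<Longrightarrow> \<bar>h x - q x\<bar> \<le> \<epsilon>"
        using trig_polynomials_bounded_approximation[OF h m \<epsilon>(1), of "max R1 R2"] by blast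
      have "N.prob {x \<in> space N. max R1 R2 < norm x} \<le> N.prob {x \<in> space N. R2 < norm x}"
        by (rule N.finite_measure_mono) auto
      with R2 have R2': "N.prob {x \<in> space N. max R1 R2 < norm x} \<le> \<epsilon>" by linarith
      note qc = trig_polynomials_continuous[OF q(1)]
      have b: "\<epsilon> + (m + (m + \<epsilon>)) * \<epsilon> \<le> e / 2 - \<epsilon>"
      proof -
        have "\<epsilon> * \<epsilon> \<le> \<epsilon> * 1" using \<epsilon> by (intro mult_left_mono) auto
        moreover have "\<epsilon> + (m + (m + \<epsilon>)) * \<epsilon> = \<epsilon> + 2 * (m * \<epsilon>) + \<epsilon> * \<epsilon>"
          by (simp add: algebra_simps)
        moreover have "4 * (m * \<epsilon>) + 8 * \<epsilon> \<le> e"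
          using \<epsilon>e by (simp add: algebra_simps)
        ultimately show ?thesis using \<epsilon>(1) by linarith
      qed
      have "(\<lambda>x. x) \<in> borel_measurable N" by simp
      note Nq = N.integral_approximation[OF this h m qc q(2,3) less_imp_le[OF \<epsilon>(1)] R2']
      have "\<forall>\<^sub>F n in sequentially. dist (expectation (\<lambda>\<omega>. q (X n \<omega>))) (integral\<^sup>L N q) < \<epsilon>"
        using tendstoD[OF trig[OF q(1)] \<epsilon>(1)] .
      then show "\<forall>\<^sub>F n in sequentially. dist (expectation (\<lambda>\<omega>. h (X n \<omega>))) (integral\<^sup>L N h) < e"
        using R1
      proof eventually_elim
        case (elim n)
        have "prob {\<omega> \<in> space M. max R1 R2 < norm (X n \<omega>)} \<le> prob {\<omega> \<in> space M. R1 < norm (X n \<omega>)}"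
          by (rule finite_measure_mono) auto
        with elim(2) have R1': "prob {\<omega> \<in> space M. max R1 R2 < norm (X n \<omega>)} \<le> \<epsilon>" by linarith
        note integral_approximation[OF X h m qc q(2,3) less_imp_le[OF \<epsilon>(1)] R1']
        with elim(1) Nq b \<epsilon> show ?case
          unfolding dist_real_def by linarith
      qed
    qed
  qed
qed

lemma abs_sin_diff_le: "\<bar>sin x - sin y\<bar> \<le> \<bar>x - y\<bar>" for x y :: real
proof -
  have "\<bar>sin x - sin y\<bar> = 2 * \<bar>sin ((x - y) / 2)\<bar> * \<bar>cos ((x + y) / 2)\<bar>"
    by (simp add: sin_diff_sin abs_mult)
  also have "\<dots> \<le> 2 * \<bar>(x - y) / 2\<bar> * 1"
    by (intro mult_mono abs_sin_x_le_abs_x) auto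
  finally show ?thesis by simp
qed

lemma abs_cos_diff_le: "\<bar>cos x - cos y\<bar> \<le> \<bar>x - y\<bar>" for x y :: real
  using abs_sin_diff_le[of "pi / 2 - x" "pi / 2 - y"] by (simp add: cos_sin_eq abs_minus_commute)

section \<open>Central limit theorem for asymptotically linear sequences\<close>

lemma std_normal_prob_space: "prob_space (density lborel (\<lambda>x. ennreal (std_normal_density x)))"
  by (rule prob_space_normal_density) simp

lemma prob_space_standard_normal_vector: "prob_space standard_normal_vector"
proof -
  interpret product_prob_space "\<lambda>_ :: 'a. density lborel (\<lambda>x. ennreal (std_normal_density x))" UNIV
    by (intro product_prob_spaceI std_normal_prob_space)
  show ?thesis
    unfolding standard_normal_vector_def
    by (rule prob_space_distr, rule borel_measurable_vec_lambda) measurable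
qed

text \<open>The complex exponential factorizes over the independent coordinates, while its real and
  imaginary parts do not; both integrals are therefore read off from the characteristic
  function.\<close>

lemma
  fixes t :: "real^'n"
  shows standard_normal_vector_cos: "(\<integral>z. cos (t \<bullet> z) \<partial>standard_normal_vector) = exp (- (t \<bullet> t) / 2)"
    and standard_normal_vector_sin: "(\<integral>z. sin (t \<bullet> z) \<partial>standard_normal_vector) = 0"
proof -
  let ?D = "density lborel (\<lambda>x. ennreal (std_normal_density x))"
  let ?P = "PiM (UNIV :: 'n set) (\<lambda>_. ?D)"
  interpret D: prob_space ?D by (rule std_normal_prob_space)
  interpret product_prob_space "\<lambda>_ :: 'n. ?D" UNIV
    by (intro product_prob_spaceI std_normal_prob_space)
  interpret N: prob_space "standard_normal_vector :: (real^'n) measure"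
    by (rule prob_space_standard_normal_vector)
  have m: "(\<lambda>z. \<chi> i. z i) \<in> measurable ?P (borel :: (real^'n) measure)"
    by (rule borel_measurable_vec_lambda) measurable
  have [simp]: "space standard_normal_vector = UNIV" "sets standard_normal_vector = sets borel"
    by (simp_all add: standard_normal_vector_def)
  have "(\<integral>z. iexp (t \<bullet> z) \<partial>standard_normal_vector) = (\<integral>z. iexp (t \<bullet> (\<chi> i. z i)) \<partial>?P)"
    unfolding standard_normal_vector_def by (rule integral_distr[OF m]) measurable
  also have "\<dots> = (\<integral>z. (\<Prod>i\<in>UNIV. iexp (t $ i * z i)) \<partial>?P)"
    by (simp add: inner_vec_def sum_distrib_left exp_sum)
  also have "\<dots> = (\<Prod>i\<in>UNIV. \<integral>x. iexp (t $ i * x) \<partial>?D)"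
    by (rule product_integral_prod) (auto intro!: D.integrable_const_bound[where B = 1])
  also have "\<dots> = (\<Prod>i\<in>UNIV. complex_of_real (exp (- ((t $ i)\<^sup>2) / 2)))"
    using fun_cong[OF char_std_normal_distribution] by (simp add: char_def)
  also have "\<dots> = complex_of_real (exp (- (t \<bullet> t) / 2))"
  proof -
    have "(\<Prod>i\<in>UNIV. exp (- ((t $ i)\<^sup>2) / 2)) = exp (\<Sum>i\<in>UNIV. - ((t $ i)\<^sup>2) / 2)"
      by (simp add: exp_sum)
    also have "(\<Sum>i\<in>UNIV. - ((t $ i)\<^sup>2) / 2) = - (t \<bullet> t) / 2"
      by (simp add: inner_vec_def power2_eq_square sum_negf sum_divide_distrib)
    finally show ?thesis by (simp only: of_real_prod[symmetric])
  qed
  finally have eq: "(\<integral>z. iexp (t \<bullet> z) \<partial>standard_normal_vector) = complex_of_real (exp (- (t \<bullet> t) / 2))" .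
  have int: "integrable standard_normal_vector (\<lambda>z. iexp (t \<bullet> z))"
  proof (rule N.integrable_const_bound[where B = 1])
    have "(\<lambda>z. iexp (t \<bullet> z)) \<in> borel_measurable borel"
      by measurable
    then show "(\<lambda>z. iexp (t \<bullet> z)) \<in> borel_measurable standard_normal_vector"
      by (subst measurable_cong_sets[where M' = borel and N' = borel]) simp_all
  qed simp
  show "(\<integral>z. cos (t \<bullet> z) \<partial>standard_normal_vector) = exp (- (t \<bullet> t) / 2)"
    using integral_Re[OF int] by (simp add: eq Re_exp)
  show "(\<integral>z. sin (t \<bullet> z) \<partial>standard_normal_vector) = 0"
    using integral_Im[OF int] by (simp add: eq Im_exp)
qed

context prob_space begin

text \<open>The central limit theorem is used for the sum standardized by its variance. Evaluating
  the characteristic functions at \<open>sqrt v\<close> undoes this standardization, so the limit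
  need not be rescaled.\<close>

lemma
  fixes X :: "nat \<Rightarrow> 'a \<Rightarrow> real"
  assumes indep: "indep_vars (\<lambda>_. borel) X UNIV"
    and law: "\<And>i. distr M borel (X i) = \<mu>"
    and sq: "\<And>i. integrable M (\<lambda>\<omega>. (X i \<omega>)\<^sup>2)"
    and mean: "\<And>i. expectation (X i) = 0"
    and var: "\<And>i. expectation (\<lambda>\<omega>. (X i \<omega>)\<^sup>2) = v" and "v > 0"
  shows cos_clt: "(\<lambda>n. expectation (\<lambda>\<omega>. cos ((\<Sum>i<n. X i \<omega>) / sqrt (real n)))) \<longlonglongrightarrow> exp (- v / 2)"
    and sin_clt: "(\<lambda>n. expectation (\<lambda>\<omega>. sin ((\<Sum>i<n. X i \<omega>) / sqrt (real n)))) \<longlonglongrightarrow> 0"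
proof -
  have rv [measurable]: "random_variable borel (X i)" for i
    using indep by (simp add: indep_vars_def2)
  let ?S = "\<lambda>n \<omega>. (\<Sum>i<n. X i \<omega>) / sqrt (real n * (sqrt v)\<^sup>2)"
  have S [measurable]: "random_variable borel (?S n)" for n by measurable
  have wc: "weak_conv_m (\<lambda>n. distr M borel (?S n)) std_normal_distribution"
    by (rule central_limit_theorem_zero_mean[OF indep mean _ sq _ law]) (use mean var \<open>v > 0\<close> in auto)
  have scale: "sqrt v * ?S n \<omega> = (\<Sum>i<n. X i \<omega>) / sqrt (real n)" for n \<omega>
    using \<open>v > 0\<close> by (simp add: real_sqrt_mult)
  have conv: "(\<lambda>n. expectation (\<lambda>\<omega>. iexp ((\<Sum>i<n. X i \<omega>) / sqrt (real n)))) \<longlonglongrightarrow> complex_of_real (exp (- v / 2))"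
  proof -
    have "(\<lambda>n. char (distr M borel (?S n)) (sqrt v)) \<longlonglongrightarrow> char std_normal_distribution (sqrt v)"
      by (rule levy_continuity1[OF _ real_dist_normal_dist wc]) (simp add: real_distribution_distr)
    moreover have "char (distr M borel (?S n)) (sqrt v)
        = expectation (\<lambda>\<omega>. iexp ((\<Sum>i<n. X i \<omega>) / sqrt (real n)))" for n
      unfolding char_def by (subst integral_distr[OF S]) (simp_all only: scale, simp)
    ultimately show ?thesis
      using \<open>v > 0\<close> by (simp add: char_std_normal_distribution)
  qed
  note conv = conv[folded cis_conv_exp]
  have int: "integrable M (\<lambda>\<omega>. cis ((\<Sum>i<n. X i \<omega>) / sqrt (real n)))" for n
    by (rule integrable_const_bound[where B = 1]) (auto simp: cis_conv_exp)
  show "(\<lambda>n. expectation (\<lambda>\<omega>. cos ((\<Sum>i<n. X i \<omega>) / sqrt (real n)))) \<longlonglongrightarrow> exp (- v / 2)"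
    using tendsto_Re[OF conv] by (simp add: integral_Re[OF int, symmetric])
  show "(\<lambda>n. expectation (\<lambda>\<omega>. sin ((\<Sum>i<n. X i \<omega>) / sqrt (real n)))) \<longlonglongrightarrow> 0"
    using tendsto_Im[OF conv] by (simp add: integral_Im[OF int, symmetric])
qed

text \<open>The assumptions on \<open>f\<close> are those shared by \<open>cos\<close> and
  \<open>sin\<close>. The Lipschitz bound is used where the two variables are close, the bound by 1
  on the remaining event.\<close>

lemma expectation_difference_tendsto_0:
  fixes X X' :: "nat \<Rightarrow> 'a \<Rightarrow> 'b::euclidean_space" and f :: "real \<Rightarrow> real"
  assumes [measurable]: "\<And>n. random_variable borel (X n)" "\<And>n. random_variable borel (X' n)"
    and close: "\<And>\<eta>. \<eta> > 0 \<Longrightarrow> (\<lambda>n. prob {\<omega> \<in> space M. \<eta> \<le> norm (X n \<omega> - X' n \<omega>)}) \<longlonglongrightarrow> 0"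
    and f: "continuous_on UNIV f" "\<And>x. \<bar>f x\<bar> \<le> 1" "\<And>x y. \<bar>f x - f y\<bar> \<le> \<bar>x - y\<bar>"
  shows "(\<lambda>n. expectation (\<lambda>\<omega>. f (t \<bullet> X n \<omega>)) - expectation (\<lambda>\<omega>. f (t \<bullet> X' n \<omega>))) \<longlonglongrightarrow> 0"
proof (rule LIMSEQ_I)
  fix \<epsilon> :: real assume "\<epsilon> > 0"
  note [measurable] = borel_measurable_continuous_onI[OF f(1)]
  \<comment> \<open>This keeps \<open>norm t * \<eta>\<close> at most \<epsilon>/2, also for t = 0
    thanks to the added 1; the exceptional event contributes twice a probability below
    \<epsilon>/4.\<close>
  define \<eta> where "\<eta> = \<epsilon> / (2 * (norm t + 1))"
  have nt: "norm t + 1 > 0" using norm_ge_zero[of t] by linarith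
  have \<eta>: "\<eta> > 0" using \<open>\<epsilon> > 0\<close> nt by (simp add: \<eta>_def)
  have "norm t * \<eta> \<le> (norm t + 1) * \<eta>" using \<eta> by (intro mult_right_mono) auto
  also have "(norm t + 1) * \<eta> = \<epsilon> / 2" using nt unfolding \<eta>_def by (simp add: field_simps)
  finally have t\<eta>: "norm t * \<eta> \<le> \<epsilon> / 2" .
  define A where "A n = {\<omega> \<in> space M. \<eta> \<le> norm (X n \<omega> - X' n \<omega>)}" for n
  have A: "A n \<in> sets M" for n unfolding A_def by measurable
  have int: "integrable M (\<lambda>\<omega>. f (t \<bullet> X n \<omega>))" "integrable M (\<lambda>\<omega>. f (t \<bullet> X' n \<omega>))" for n
    by (rule integrable_const_bound[where B = 1]; use f(2) in simp)+
  have iA: "integrable M (\<lambda>\<omega>. norm t * \<eta> + 2 * indicator (A n) \<omega>)" for n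
    using A[of n] by (intro Bochner_Integration.integrable_add integrable_mult_right
        integrable_real_indicator) (auto simp: less_top[symmetric])
  have pw: "\<bar>f (t \<bullet> X n \<omega>) - f (t \<bullet> X' n \<omega>)\<bar> \<le> norm t * \<eta> + 2 * indicator (A n) \<omega>"
    if "\<omega> \<in> space M" for n \<omega>
  proof (cases "\<omega> \<in> A n")
    case True
    have "\<bar>f (t \<bullet> X n \<omega>) - f (t \<bullet> X' n \<omega>)\<bar> \<le> 2"
      using f(2)[of "t \<bullet> X n \<omega>"] f(2)[of "t \<bullet> X' n \<omega>"] by linarith
    moreover have "0 \<le> norm t * \<eta>" using \<eta> by simp
    ultimately show ?thesis using True by simp
  next
    case False
    then have "norm (X n \<omega> - X' n \<omega>) \<le> \<eta>" using that by (auto simp: A_def)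
    have "\<bar>f (t \<bullet> X n \<omega>) - f (t \<bullet> X' n \<omega>)\<bar> \<le> \<bar>t \<bullet> (X n \<omega> - X' n \<omega>)\<bar>"
      using f(3) by (simp add: inner_diff_right)
    also have "\<dots> \<le> norm t * norm (X n \<omega> - X' n \<omega>)"
      by (rule Cauchy_Schwarz_ineq2)
    also have "\<dots> \<le> norm t * \<eta>"
      using \<open>norm (X n \<omega> - X' n \<omega>) \<le> \<eta>\<close> by (intro mult_left_mono) auto
    finally show ?thesis using False by simp
  qed
  have bound: "\<bar>expectation (\<lambda>\<omega>. f (t \<bullet> X n \<omega>)) - expectation (\<lambda>\<omega>. f (t \<bullet> X' n \<omega>))\<bar> \<le> norm t * \<eta> + 2 * prob (A n)" for n
  proof -
    have "\<bar>expectation (\<lambda>\<omega>. f (t \<bullet> X n \<omega>)) - expectation (\<lambda>\<omega>. f (t \<bullet> X' n \<omega>))\<bar>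
        = \<bar>expectation (\<lambda>\<omega>. f (t \<bullet> X n \<omega>) - f (t \<bullet> X' n \<omega>))\<bar>"
      using int by simp
    also have "\<dots> \<le> expectation (\<lambda>\<omega>. \<bar>f (t \<bullet> X n \<omega>) - f (t \<bullet> X' n \<omega>)\<bar>)"
      by (rule integral_abs_bound)
    also have "\<dots> \<le> expectation (\<lambda>\<omega>. norm t * \<eta> + 2 * indicator (A n) \<omega>)"
      using int pw by (intro integral_mono iA) auto
    also have "\<dots> = norm t * \<eta> + 2 * prob (A n)"
      using A by (simp add: prob_space less_top[symmetric])
    finally show ?thesis .
  qed
  have "\<forall>\<^sub>F n in sequentially. prob (A n) < \<epsilon> / 4"
    using close[OF \<eta>] \<open>\<epsilon> > 0\<close> unfolding A_def by (intro order_tendstoD) auto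
  then obtain N where N: "\<And>n. n \<ge> N \<Longrightarrow> prob (A n) < \<epsilon> / 4"
    by (auto simp: eventually_sequentially)
  show "\<exists>N. \<forall>n\<ge>N. norm (expectation (\<lambda>\<omega>. f (t \<bullet> X n \<omega>)) - expectation (\<lambda>\<omega>. f (t \<bullet> X' n \<omega>)) - 0) < \<epsilon>"
  proof (intro exI allI impI)
    fix n assume "N \<le> n"
    then show "norm (expectation (\<lambda>\<omega>. f (t \<bullet> X n \<omega>)) - expectation (\<lambda>\<omega>. f (t \<bullet> X' n \<omega>)) - 0) < \<epsilon>"
      using bound[of n] N[of n] t\<eta> by simp
  qed
qed

text \<open>This isolates the probabilistic half of the argument from the model. Because the assumed
  error is relative to \<open>norm (s n \<omega>)\<close>, the sequence \<open>s\<close> has to be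
  shown tight before the error becomes negligible.\<close>

lemma asymptotically_linear_normal:
  fixes Y :: "nat \<Rightarrow> 'a \<Rightarrow> 'b::topological_space" and \<psi> :: "'b \<Rightarrow> real^'p"
    and P :: "real^'p^'p" and X :: "nat \<Rightarrow> 'a \<Rightarrow> real^'p"
  defines "s \<equiv> \<lambda>n \<omega>. (\<Sum>i<n. \<psi> (Y i \<omega>)) /\<^sub>R sqrt (real n)"
  assumes indep: "indep_vars (\<lambda>_. borel) Y UNIV"
    and law: "\<And>i. distr M borel (Y i) = L"
    and int: "\<And>i. integrable L (\<lambda>y. \<psi> y $ i)"
    and mean: "\<And>i. (\<integral>y. \<psi> y $ i \<partial>L) = 0"
    and int2: "\<And>i j. integrable L (\<lambda>y. \<psi> y $ i * \<psi> y $ j)"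
    and J: "\<And>i j. J $ i $ j = (\<integral>y. \<psi> y $ i * \<psi> y $ j \<partial>L)"
    and pd: "positive_definite J"
    and X [measurable]: "\<And>n. random_variable borel (X n)"
    and linear: "\<And>\<epsilon>. \<epsilon> > 0 \<Longrightarrow> with_probability_tending_to_one M
        (\<lambda>n \<omega>. norm (X n \<omega> - P *v s n \<omega>) \<le> \<epsilon> * norm (s n \<omega>))"
  shows "\<exists>N. is_multivariate_normal 0 (P ** J ** transpose P) N \<and> converges_in_law M X N"
proof -
  have Y [measurable]: "random_variable borel (Y i)" for i
    using indep by (simp add: indep_vars_def2)
  have sets_L [measurable_cong]: "sets L = sets borel"
    using law[of 0] by auto
  \<comment> \<open>Measurability of \<open>\<psi>\<close> is recovered from the integrability of
    its coordinates.\<close>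
  have "(\<lambda>y. \<psi> y $ i) \<in> borel_measurable L" for i
    by (rule borel_measurable_integrable[OF int])
  then have "(\<lambda>y. \<psi> y $ i) \<in> borel_measurable borel" for i
    by (simp add: measurable_cong_sets[OF sets_L refl])
  then have "(\<lambda>y. \<chi> i. \<psi> y $ i) \<in> borel_measurable borel"
    by (rule borel_measurable_vec_lambda)
  then have \<psi> [measurable]: "\<psi> \<in> borel_measurable borel"
    by simp
  have s [measurable]: "random_variable borel (s n)" for n
    unfolding s_def by measurable
  have Pm [measurable]: "(\<lambda>x. P *v x) \<in> borel_measurable borel"
    by (intro borel_measurable_continuous_onI matrix_vector_mult_linear_continuous_on)

  have ws: "w \<bullet> s n \<omega> = (\<Sum>i<n. w \<bullet> \<psi> (Y i \<omega>)) / sqrt (real n)" for w n \<omega>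
    by (simp add: s_def inner_sum_right divide_inverse mult.commute)
  have \<psi>_int: "integrable M (\<lambda>\<omega>. w \<bullet> \<psi> (Y i \<omega>))" and \<psi>_mean: "expectation (\<lambda>\<omega>. w \<bullet> \<psi> (Y i \<omega>)) = 0" for w i
  proof -
    have w: "(\<lambda>y. w \<bullet> \<psi> y) = (\<lambda>y. \<Sum>k\<in>UNIV. w $ k * \<psi> y $ k)"
      by (simp add: inner_vec_def)
    have "integrable L (\<lambda>y. w \<bullet> \<psi> y)" "(\<integral>y. w \<bullet> \<psi> y \<partial>L) = 0"
      using int mean by (simp_all add: w)
    then show "integrable M (\<lambda>\<omega>. w \<bullet> \<psi> (Y i \<omega>))" "expectation (\<lambda>\<omega>. w \<bullet> \<psi> (Y i \<omega>)) = 0"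
      using integrable_distr_eq[OF Y, of "\<lambda>y. w \<bullet> \<psi> y" i] integral_distr[OF Y, of "\<lambda>y. w \<bullet> \<psi> y" i]
      by (simp_all add: law)
  qed
  have \<psi>_sq: "integrable M (\<lambda>\<omega>. (w \<bullet> \<psi> (Y i \<omega>))\<^sup>2)"
    and \<psi>_var: "expectation (\<lambda>\<omega>. (w \<bullet> \<psi> (Y i \<omega>))\<^sup>2) = w \<bullet> (J *v w)" for w i
  proof -
    have w: "(\<lambda>y. (w \<bullet> \<psi> y)\<^sup>2) = (\<lambda>y. \<Sum>k\<in>UNIV. \<Sum>l\<in>UNIV. (w $ k * w $ l) * (\<psi> y $ k * \<psi> y $ l))"
      by (simp add: inner_vec_def power2_eq_square sum_product mult.commute mult.left_commute)
    have "integrable L (\<lambda>y. (w \<bullet> \<psi> y)\<^sup>2)"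
      unfolding w using int2 by (intro Bochner_Integration.integrable_sum integrable_mult_right)
    moreover have "(\<integral>y. (w \<bullet> \<psi> y)\<^sup>2 \<partial>L) = (\<Sum>k\<in>UNIV. \<Sum>l\<in>UNIV. (w $ k * w $ l) * J $ k $ l)"
      unfolding w J using int2
      by (subst Bochner_Integration.integral_sum
        | intro sum.cong refl Bochner_Integration.integrable_sum integrable_mult_right | simp)+
    moreover have "\<dots> = w \<bullet> (J *v w)"
      by (simp add: inner_vec_def matrix_vector_mult_def sum_distrib_left mult_ac)
    ultimately show "integrable M (\<lambda>\<omega>. (w \<bullet> \<psi> (Y i \<omega>))\<^sup>2)"
      "expectation (\<lambda>\<omega>. (w \<bullet> \<psi> (Y i \<omega>))\<^sup>2) = w \<bullet> (J *v w)"
      using integrable_distr_eq[OF Y, of "\<lambda>y. (w \<bullet> \<psi> y)\<^sup>2" i]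
        integral_distr[OF Y, of "\<lambda>y. (w \<bullet> \<psi> y)\<^sup>2" i]
      by (simp_all add: law)
  qed
  have \<psi>_ind: "indep_vars (\<lambda>_. borel) (\<lambda>i \<omega>. w \<bullet> \<psi> (Y i \<omega>)) UNIV" for w
    by (rule indep_vars_compose2[OF indep]) simp
  have \<psi>_law: "distr M borel (\<lambda>\<omega>. w \<bullet> \<psi> (Y i \<omega>)) = distr L borel (\<lambda>y. w \<bullet> \<psi> y)" for w i
    using distr_distr[OF _ Y, of "\<lambda>y. w \<bullet> \<psi> y" borel i] law by (simp add: comp_def)

  have cos_s: "(\<lambda>n. expectation (\<lambda>\<omega>. cos (w \<bullet> s n \<omega>))) \<longlonglongrightarrow> exp (- (w \<bullet> (J *v w)) / 2)"
    and sin_s: "(\<lambda>n. expectation (\<lambda>\<omega>. sin (w \<bullet> s n \<omega>))) \<longlonglongrightarrow> 0" for w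
  proof -
    have "(\<lambda>n. expectation (\<lambda>\<omega>. cos (w \<bullet> s n \<omega>))) \<longlonglongrightarrow> exp (- (w \<bullet> (J *v w)) / 2) \<and>
        (\<lambda>n. expectation (\<lambda>\<omega>. sin (w \<bullet> s n \<omega>))) \<longlonglongrightarrow> 0"
    \<comment> \<open>The central limit theorem requires positive variance, which positive
      definiteness gives only for nonzero w. The zero case really occurs: later w is P^T t, and P
      may be singular.\<close>
    proof (cases "w = 0")
      case True
      then show ?thesis by (simp add: prob_space)
    next
      case False
      then have "0 < w \<bullet> (J *v w)"
        using pd by (simp add: positive_definite_def)
      then show ?thesis
        unfolding ws
        using cos_clt[OF \<psi>_ind \<psi>_law \<psi>_sq \<psi>_mean \<psi>_var] sin_clt[OF \<psi>_ind \<psi>_law \<psi>_sq \<psi>_mean \<psi>_var]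
        by blast
    qed
    then show "(\<lambda>n. expectation (\<lambda>\<omega>. cos (w \<bullet> s n \<omega>))) \<longlonglongrightarrow> exp (- (w \<bullet> (J *v w)) / 2)"
      "(\<lambda>n. expectation (\<lambda>\<omega>. sin (w \<bullet> s n \<omega>))) \<longlonglongrightarrow> 0" by auto
  qed

  \<comment> \<open>The trace of J, which is the mean of the squared norm of \<open>s n\<close> for
    every positive n.\<close>
  define \<tau> where "\<tau> = (\<Sum>j\<in>UNIV. J $ j $ j)"
  have J_axis: "axis j 1 \<bullet> (J *v axis j 1) = J $ j $ j" for j
    by (simp add: inner_axis' matrix_vector_mult_basis column_def)
  have \<tau>0: "0 \<le> \<tau>"
    unfolding \<tau>_def J by (intro sum_nonneg integral_nonneg) auto
  have s_tail: "prob {\<omega> \<in> space M. R \<le> norm (s n \<omega>)} \<le> \<tau> / R\<^sup>2" if "R > 0" for R n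
  proof -
    have sq: "(norm (s n \<omega>))\<^sup>2 = (\<Sum>j\<in>UNIV. (\<Sum>i<n. axis j 1 \<bullet> \<psi> (Y i \<omega>))\<^sup>2) / real n" for \<omega>
    proof -
      have "(norm (s n \<omega>))\<^sup>2 = (\<Sum>j\<in>UNIV. (axis j 1 \<bullet> s n \<omega>)\<^sup>2)"
        unfolding power2_norm_eq_inner
        by (simp add: inner_vec_def[of "s n \<omega>" "s n \<omega>"] inner_axis' power2_eq_square)
      also have "\<dots> = (\<Sum>j\<in>UNIV. (\<Sum>i<n. axis j 1 \<bullet> \<psi> (Y i \<omega>))\<^sup>2) / real n"
        unfolding ws
        by (simp only: power_divide sum_divide_distrib[symmetric] real_sqrt_pow2 of_nat_0_le_iff)
      finally show ?thesis .
    qed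
    note m2 = integrable_square_indep_sum[OF \<psi>_ind \<psi>_sq \<psi>_mean \<psi>_var]
      second_moment_indep_sum[OF \<psi>_ind \<psi>_sq \<psi>_mean \<psi>_var]
    have i: "integrable M (\<lambda>\<omega>. (norm (s n \<omega>))\<^sup>2)"
      unfolding sq by (intro integrable_divide Bochner_Integration.integrable_sum m2)
    have "expectation (\<lambda>\<omega>. (norm (s n \<omega>))\<^sup>2) =
        (\<Sum>j\<in>UNIV. expectation (\<lambda>\<omega>. (\<Sum>i<n. axis j 1 \<bullet> \<psi> (Y i \<omega>))\<^sup>2)) / real n"
      unfolding sq by (subst integral_divide_zero, subst Bochner_Integration.integral_sum) (simp_all add: m2)
    also have "\<dots> = (\<Sum>j\<in>UNIV. real n * J $ j $ j) / real n"
      by (simp only: m2 J_axis)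
    also have "\<dots> \<le> \<tau>"
      using \<tau>0 by (cases "n = 0") (simp_all add: \<tau>_def sum_distrib_left[symmetric])
    finally have e: "expectation (\<lambda>\<omega>. (norm (s n \<omega>))\<^sup>2) \<le> \<tau>" .
    have "prob {\<omega> \<in> space M. R \<le> norm (s n \<omega>)} = prob {\<omega> \<in> space M. R \<le> \<bar>norm (s n \<omega>)\<bar>}"
      by simp
    also have "\<dots> \<le> expectation (\<lambda>\<omega>. (norm (s n \<omega>))\<^sup>2) / R\<^sup>2"
      by (rule second_moment_method) (use i that in auto)
    also have "\<dots> \<le> \<tau> / R\<^sup>2"
      using e by (simp add: divide_right_mono)
    finally show ?thesis .
  qed
  have s_tight: "\<exists>R>0. \<forall>n. prob {\<omega> \<in> space M. R \<le> norm (s n \<omega>)} \<le> \<epsilon>" if "\<epsilon> > 0" for \<epsilon>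
  proof -
    \<comment> \<open>Chebyshev's bound becomes \<epsilon> \<tau>/(\<tau> + 1); the added 1 makes
      \<open>R\<close> positive from \<open>0 \<le> \<tau>\<close> alone.\<close>
    define R where "R = sqrt ((\<tau> + 1) / \<epsilon>)"
    have R: "R > 0" "R\<^sup>2 = (\<tau> + 1) / \<epsilon>"
      using \<tau>0 that by (auto simp: R_def)
    have "\<tau> / R\<^sup>2 \<le> \<epsilon>"
      using \<tau>0 that unfolding R(2) by (simp add: field_simps)
    then show ?thesis
      using s_tail[OF R(1)] R(1) by (intro exI[of _ R]) (auto intro: order_trans)
  qed

  have close: "(\<lambda>n. prob {\<omega> \<in> space M. \<eta> \<le> norm (X n \<omega> - P *v s n \<omega>)}) \<longlonglongrightarrow> 0" if "\<eta> > 0" for \<eta>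
  proof (rule LIMSEQ_I)
    fix \<epsilon> :: real assume "\<epsilon> > 0"
    obtain R where R: "R > 0" "\<And>n. prob {\<omega> \<in> space M. R \<le> norm (s n \<omega>)} \<le> \<epsilon> / 2"
      using s_tight[of "\<epsilon> / 2"] \<open>\<epsilon> > 0\<close> by auto
    \<comment> \<open>Where \<open>norm (s n \<omega>)\<close> is below \<open>R\<close>, a relative
      error \<delta> is an absolute error of at most \<eta>/2.\<close>
    define \<delta> where "\<delta> = \<eta> / (2 * R)"
    have \<delta>: "\<delta> > 0" "\<delta> * R < \<eta>" using that R(1) by (auto simp: \<delta>_def)
    obtain E where E: "\<And>n. E n \<in> sets M" "(\<lambda>n. prob (E n)) \<longlonglongrightarrow> 1"
      "\<And>n \<omega>. \<omega> \<in> E n \<Longrightarrow> norm (X n \<omega> - P *v s n \<omega>) \<le> \<delta> * norm (s n \<omega>)"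
      using linear[OF \<delta>(1)] unfolding with_probability_tending_to_one_def by blast
    have bound: "prob {\<omega> \<in> space M. \<eta> \<le> norm (X n \<omega> - P *v s n \<omega>)} \<le> (1 - prob (E n)) + \<epsilon> / 2" for n
    proof -
      let ?B = "{\<omega> \<in> space M. R \<le> norm (s n \<omega>)}"
      have B: "?B \<in> sets M" by measurable
      have "{\<omega> \<in> space M. \<eta> \<le> norm (X n \<omega> - P *v s n \<omega>)} \<subseteq> (space M - E n) \<union> ?B"
      proof
        fix \<omega> assume \<omega>: "\<omega> \<in> {\<omega> \<in> space M. \<eta> \<le> norm (X n \<omega> - P *v s n \<omega>)}"
        have "R \<le> norm (s n \<omega>)" if "\<omega> \<in> E n"
        proof (rule ccontr)
          assume "\<not> R \<le> norm (s n \<omega>)"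
          then have "\<delta> * norm (s n \<omega>) \<le> \<delta> * R" using \<delta>(1) by (intro mult_left_mono) auto
          then show False using E(3)[OF that] \<delta>(2) \<omega> by simp
        qed
        then show "\<omega> \<in> (space M - E n) \<union> ?B" using \<omega> by blast
      qed
      then have "prob {\<omega> \<in> space M. \<eta> \<le> norm (X n \<omega> - P *v s n \<omega>)} \<le> prob ((space M - E n) \<union> ?B)"
        using E(1) B by (intro finite_measure_mono) auto
      also have "\<dots> \<le> prob (space M - E n) + prob ?B"
        using E(1) B by (intro measure_Un_le) auto
      also have "\<dots> \<le> (1 - prob (E n)) + \<epsilon> / 2"
        using R(2)[of n] by (simp add: prob_compl[OF E(1)])
      finally show ?thesis .
    qed
    have "\<forall>\<^sub>F n in sequentially. prob (E n) > 1 - \<epsilon> / 2"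
      using E(2) \<open>\<epsilon> > 0\<close> by (intro order_tendstoD) auto
    then obtain n0 where n0: "\<And>n. n \<ge> n0 \<Longrightarrow> prob (E n) > 1 - \<epsilon> / 2"
      by (auto simp: eventually_sequentially)
    show "\<exists>n0. \<forall>n\<ge>n0. norm (prob {\<omega> \<in> space M. \<eta> \<le> norm (X n \<omega> - P *v s n \<omega>)} - 0) < \<epsilon>"
    proof (intro exI allI impI)
      fix n assume "n0 \<le> n"
      then show "norm (prob {\<omega> \<in> space M. \<eta> \<le> norm (X n \<omega> - P *v s n \<omega>)} - 0) < \<epsilon>"
        using n0[of n] bound[of n] by simp
    qed
  qed

  obtain B :: "real^'p^'p" where B: "B ** transpose B = J"
    using positive_definite_factorization[OF pd] .
  \<comment> \<open>The factorization is applied to J, which is positive definite, and transported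
    by P; the covariance itself may be singular.\<close>
  define A where "A = P ** B"
  define N where "N = distr standard_normal_vector borel (\<lambda>z. 0 + A *v z)"
  have AA: "A ** transpose A = P ** J ** transpose P"
    by (simp add: A_def matrix_transpose_mul B[symmetric] matrix_mul_assoc)
  interpret Z: prob_space "standard_normal_vector :: (real^'p) measure"
    by (rule prob_space_standard_normal_vector)
  have sets_Z [measurable_cong]: "sets (standard_normal_vector :: (real^'p) measure) = sets borel"
    by (simp add: standard_normal_vector_def)
  have Am0: "(\<lambda>x. 0 + A *v x) \<in> borel_measurable borel"
    by (simp add: borel_measurable_continuous_onI matrix_vector_mult_linear_continuous_on)
  then have Am: "(\<lambda>x. 0 + A *v x) \<in> measurable standard_normal_vector borel"
    by (simp add: measurable_cong_sets[OF sets_Z refl])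
  have N: "prob_space N"
    unfolding N_def by (rule Z.prob_space_distr[OF Am])
  have At: "t \<bullet> (0 + A *v z) = (transpose A *v t) \<bullet> z" for t z
    by (simp add: dot_lmul_matrix)
  \<comment> \<open>The exponent of the limiting characteristic function at t is thus the variance
    of the score in the direction P^T t, which matches \<open>cos_s\<close>.\<close>
  have quad: "(transpose A *v t) \<bullet> (transpose A *v t) = (transpose P *v t) \<bullet> (J *v (transpose P *v t))" for t
  proof -
    have "(transpose A *v t) \<bullet> (transpose A *v t) = t \<bullet> (A *v (transpose A *v t))"
      using At[of t "transpose A *v t"] by simp
    also have "\<dots> = t \<bullet> (P *v (J *v (transpose P *v t)))"
      by (simp only: matrix_vector_mul_assoc AA matrix_mul_assoc)
    also have "\<dots> = (transpose P *v t) \<bullet> (J *v (transpose P *v t))"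
      by (simp add: dot_lmul_matrix)
    finally show ?thesis .
  qed
  have N_cos: "(\<integral>x. cos (t \<bullet> x) \<partial>N) = exp (- ((transpose P *v t) \<bullet> (J *v (transpose P *v t))) / 2)" for t
    unfolding N_def by (subst integral_distr[OF Am]) (simp_all only: At standard_normal_vector_cos quad, simp)
  have N_sin: "(\<integral>x. sin (t \<bullet> x) \<partial>N) = 0" for t
    unfolding N_def by (subst integral_distr[OF Am]) (simp_all only: At standard_normal_vector_sin, simp)
  have Pt: "t \<bullet> (P *v x) = (transpose P *v t) \<bullet> x" for t x
    by (simp add: dot_lmul_matrix)
  have Ps [measurable]: "random_variable borel (\<lambda>\<omega>. P *v s n \<omega>)" for n
    by measurable

  have "converges_in_law M X N"
  proof (rule converges_in_law_by_trig_functions[OF X N])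
    show "sets N = sets borel" by (simp add: N_def)
    fix t
    have "(\<lambda>n. expectation (\<lambda>\<omega>. cos (t \<bullet> X n \<omega>)) - expectation (\<lambda>\<omega>. cos (t \<bullet> (P *v s n \<omega>)))) \<longlonglongrightarrow> 0"
      by (rule expectation_difference_tendsto_0[OF X Ps close])
        (auto intro!: continuous_intros abs_cos_diff_le)
    from tendsto_add[OF this[unfolded Pt] cos_s[of "transpose P *v t"]]
    show "(\<lambda>n. expectation (\<lambda>\<omega>. cos (t \<bullet> X n \<omega>))) \<longlonglongrightarrow> (\<integral>x. cos (t \<bullet> x) \<partial>N)"
      unfolding N_cos by simp
    have "(\<lambda>n. expectation (\<lambda>\<omega>. sin (t \<bullet> X n \<omega>)) - expectation (\<lambda>\<omega>. sin (t \<bullet> (P *v s n \<omega>)))) \<longlonglongrightarrow> 0"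
      by (rule expectation_difference_tendsto_0[OF X Ps close])
        (auto intro!: continuous_intros abs_sin_diff_le)
    from tendsto_add[OF this[unfolded Pt] sin_s[of "transpose P *v t"]]
    show "(\<lambda>n. expectation (\<lambda>\<omega>. sin (t \<bullet> X n \<omega>))) \<longlonglongrightarrow> (\<integral>x. sin (t \<bullet> x) \<partial>N)"
      unfolding N_sin by simp
  next
    fix \<epsilon> :: real assume "\<epsilon> > 0"
    obtain R where R: "R > 0" "\<And>n. prob {\<omega> \<in> space M. R \<le> norm (s n \<omega>)} \<le> \<epsilon> / 2"
      using s_tight[of "\<epsilon> / 2"] \<open>\<epsilon> > 0\<close> by auto
    obtain c where c: "1 \<le> c" "\<And>x. norm (P *v x) \<le> c * norm x"
      using matrix_vector_bound[of P] by blast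
    have "\<forall>\<^sub>F n in sequentially. prob {\<omega> \<in> space M. 1 \<le> norm (X n \<omega> - P *v s n \<omega>)} < \<epsilon> / 2"
      using close[OF zero_less_one] \<open>\<epsilon> > 0\<close> by (intro order_tendstoD) auto
    \<comment> \<open>If \<open>X n\<close> is within distance 1 of P s and \<open>norm s\<close> is
      below \<open>R\<close>, then \<open>norm (X n)\<close> is at most 1 + c R; the two exceptional
      events have probability at most \<epsilon>/2 each.\<close>
    then have "\<forall>\<^sub>F n in sequentially. prob {\<omega> \<in> space M. 1 + c * R < norm (X n \<omega>)} \<le> \<epsilon>"
    proof eventually_elim
      case (elim n)
      let ?A = "{\<omega> \<in> space M. 1 \<le> norm (X n \<omega> - P *v s n \<omega>)}"
      let ?B = "{\<omega> \<in> space M. R \<le> norm (s n \<omega>)}"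
      have AB: "?A \<in> sets M" "?B \<in> sets M" by measurable
      have "{\<omega> \<in> space M. 1 + c * R < norm (X n \<omega>)} \<subseteq> ?A \<union> ?B"
      proof
        fix \<omega> assume \<omega>: "\<omega> \<in> {\<omega> \<in> space M. 1 + c * R < norm (X n \<omega>)}"
        have "R \<le> norm (s n \<omega>)" if "\<not> 1 \<le> norm (X n \<omega> - P *v s n \<omega>)"
        proof (rule ccontr)
          assume "\<not> R \<le> norm (s n \<omega>)"
          then have "c * norm (s n \<omega>) \<le> c * R" using c(1) by (intro mult_left_mono) auto
          then have "norm (P *v s n \<omega>) \<le> c * R" using c(2)[of "s n \<omega>"] by linarith
          moreover have "norm (X n \<omega>) \<le> norm (P *v s n \<omega>) + norm (X n \<omega> - P *v s n \<omega>)"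
            by (rule norm_triangle_sub)
          ultimately show False using that \<omega> by simp
        qed
        then show "\<omega> \<in> ?A \<union> ?B" using \<omega> by blast
      qed
      then have "prob {\<omega> \<in> space M. 1 + c * R < norm (X n \<omega>)} \<le> prob (?A \<union> ?B)"
        using AB by (intro finite_measure_mono) auto
      also have "\<dots> \<le> prob ?A + prob ?B"
        using AB by (rule measure_Un_le)
      also have "\<dots> \<le> \<epsilon>"
        using elim R(2)[of n] by linarith
      finally show ?case .
    qed
    then show "\<exists>R. \<forall>\<^sub>F n in sequentially. prob {\<omega> \<in> space M. R < norm (X n \<omega>)} \<le> \<epsilon>" ..
  qed
  moreover have "is_multivariate_normal 0 (P ** J ** transpose P) N"
    unfolding is_multivariate_normal_def N_def using AA by blast
  ultimately show ?thesis by blast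
qed

end

section \<open>Asymptotic normality of the restricted estimator\<close>

theorem theorem3:
  fixes \<Theta> :: "(real^'p::finite) set"
    and \<nu> :: "'m::finite \<Rightarrow> real measure"
    and f :: "real^'p \<Rightarrow> real^'m \<Rightarrow> real"
    and K :: nat and cmp :: "nat \<Rightarrow> 'm component" and w :: "nat \<Rightarrow> real"
    and CL cl :: "real^'p \<Rightarrow> real^'m \<Rightarrow> real"
    and g :: "real^'p \<Rightarrow> real^'r::finite"
    and G :: "real^'p \<Rightarrow> real^'r^'p"
    and \<theta>\<^sub>0 :: "real^'p"
    and L :: "(real^'m) measure"
    and H J :: "real^'p^'p"
    and M :: "'w measure" and Y :: "nat \<Rightarrow> 'w \<Rightarrow> real^'m"
    and est :: "nat \<Rightarrow> 'w \<Rightarrow> real^'p"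
  assumes model: "identifiable_density_family \<nu> \<Theta> f"
    and components: "\<And>k. k < K \<Longrightarrow> valid_component (cmp k)"
    and weights: "\<And>k. k < K \<Longrightarrow> 0 \<le> w k"
    and CL_eq: "CL = composite_density \<nu> f K cmp w"
    and cl_eq: "cl = (\<lambda>\<theta> y. ln (CL \<theta> y))"
    and L_eq: "L = model_law \<nu> f \<theta>\<^sub>0"
    and H_eq: "H = sensitivity_matrix L cl \<theta>\<^sub>0"
    and J_eq: "J = variability_matrix L cl \<theta>\<^sub>0"
    and G_eq: "G = constraint_matrix g"
    and r_less_p: "CARD('r) < CARD('p)"
    and G_exists: "\<And>\<theta>. \<theta> \<in> interior \<Theta> \<Longrightarrow> g differentiable (at \<theta>)"
    and G_continuous: "continuous_on (interior \<Theta>) G"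
    and G_rank: "\<And>\<theta>. \<theta> \<in> interior \<Theta> \<Longrightarrow> rank (G \<theta>) = CARD('r)"
    and true_interior: "\<theta>\<^sub>0 \<in> interior \<Theta>"
    and true_constraint: "g \<theta>\<^sub>0 = 0"
    and common_support: "\<exists>S. \<forall>\<theta>\<in>\<Theta>. {y. 0 < CL \<theta> y} = S"
    and smooth_dominated: "\<exists>U B. open U \<and> \<theta>\<^sub>0 \<in> U \<and> U \<subseteq> \<Theta> \<and> integrable L B \<and>
          (AE y in L. continuously_differentiable 3 U (\<lambda>\<theta>. cl \<theta> y) \<and>
             (\<forall>\<theta>\<in>U. \<forall>i j k. \<bar>partial i (partial j (partial k (\<lambda>t. cl t y))) \<theta>\<bar> \<le> B y))"
    and score_integrable: "\<And>i. integrable L (\<lambda>y. score cl \<theta>\<^sub>0 y $ i)"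
    and score_mean: "\<And>i. (\<integral>y. score cl \<theta>\<^sub>0 y $ i \<partial>L) = 0"
    and H_finite: "\<And>i j. integrable L (\<lambda>y. partial i (\<lambda>t. score cl t y $ j) \<theta>\<^sub>0)"
    and J_finite: "\<And>i j. integrable L (\<lambda>y. score cl \<theta>\<^sub>0 y $ i * score cl \<theta>\<^sub>0 y $ j)"
    and H_pd: "positive_definite H"
    and J_pd: "positive_definite J"
    and prob_M: "prob_space M"
    and Y_indep: "prob_space.indep_vars M (\<lambda>_. borel) Y UNIV"
    and Y_law: "\<And>i. distr M borel (Y i) = L"
    and est_measurable: "\<And>n. est n \<in> borel_measurable M"
    and est_restricted: "with_probability_tending_to_one M (\<lambda>n \<omega>.
          restricted_maximizer \<Theta> g cl n (\<lambda>i. Y i \<omega>) (est n \<omega>) \<and>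
          restricted_likelihood_equations g cl n (\<lambda>i. Y i \<omega>) (est n \<omega>))"
    and est_consistent: "converges_in_probability M est \<theta>\<^sub>0"
  shows "\<exists>N. is_multivariate_normal 0 (P_matrix H (G \<theta>\<^sub>0) ** J ** transpose (P_matrix H (G \<theta>\<^sub>0))) N \<and>
           converges_in_law M (\<lambda>n \<omega>. sqrt (real n) *\<^sub>R (est n \<omega> - \<theta>\<^sub>0)) N"
proof -
  interpret prob_space M by (rule prob_M)
  have Y [measurable]: "random_variable borel (Y i)" for i
    using Y_indep by (simp add: indep_vars_def2)
  have est [measurable]: "random_variable borel (est n)" for n
    by (rule est_measurable)
  define a where "a i j y = partial i (\<lambda>t. score cl t y $ j) \<theta>\<^sub>0" for i j y
  define \<psi> where "\<psi> = score cl \<theta>\<^sub>0"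
  define s where "s n \<omega> = (\<Sum>i<n. \<psi> (Y i \<omega>)) /\<^sub>R sqrt (real n)" for n \<omega>
  define X where "X n \<omega> = sqrt (real n) *\<^sub>R (est n \<omega> - \<theta>\<^sub>0)" for n \<omega>
  define P where "P = P_matrix H (G \<theta>\<^sub>0)"
  define p where "p = real CARD('p)"
  define q where "q = real CARD('r)"
  have p: "0 < p" and q: "0 < q" by (auto simp: p_def q_def)
  obtain U B where U: "open U" "\<theta>\<^sub>0 \<in> U" and B_int: "integrable L B"
    and good: "AE y in L. continuously_differentiable 3 U (\<lambda>\<theta>. cl \<theta> y) \<and>
             (\<forall>\<theta>\<in>U. \<forall>i j k. \<bar>partial i (partial j (partial k (\<lambda>t. cl t y))) \<theta>\<bar> \<le> B y)"
    using smooth_dominated by blast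
  obtain r where r: "0 < r" "ball \<theta>\<^sub>0 r \<subseteq> U"
    using U openE by blast
  \<comment> \<open>Countably many null sets are united, so that almost surely the smoothness and
    domination hold for all observations at once.\<close>
  have goodY: "AE \<omega> in M. \<forall>k. continuously_differentiable 3 U (\<lambda>\<theta>. cl \<theta> (Y k \<omega>)) \<and>
      (\<forall>\<theta>\<in>U. \<forall>i j l. \<bar>partial i (partial j (partial l (\<lambda>t. cl t (Y k \<omega>)))) \<theta>\<bar> \<le> B (Y k \<omega>))"
    unfolding AE_all_countable
  proof
    fix k
    show "AE \<omega> in M. continuously_differentiable 3 U (\<lambda>\<theta>. cl \<theta> (Y k \<omega>)) \<and>
      (\<forall>\<theta>\<in>U. \<forall>i j l. \<bar>partial i (partial j (partial l (\<lambda>t. cl t (Y k \<omega>)))) \<theta>\<bar> \<le> B (Y k \<omega>))"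
      by (rule AE_distrD[OF Y[of k]]) (simp only: Y_law good)
  qed
  have H_entry: "H $ i $ j = - integral\<^sup>L L (a i j)" for i j
    by (simp add: H_eq sensitivity_matrix_def a_def[abs_def])
  \<comment> \<open>In \<open>H\<close> the row index is the direction of differentiation, in the
    empirical matrix \<open>A\<close> below it is the score component; symmetry reconciles the
    two.\<close>
  have H_sym: "H $ i $ j = H $ j $ i" for i j
  proof -
    have "transpose H = H" using H_pd by (simp add: positive_definite_def)
    then show ?thesis by (simp add: vec_eq_iff transpose_def)
  qed
  have inj: "inj ((*v) (G \<theta>\<^sub>0))"
    using G_rank[OF true_interior] by (simp add: full_rank_injective)
  obtain C \<epsilon>\<^sub>0 where C: "C > 0" "\<epsilon>\<^sub>0 > 0"
    and solve: "\<And>\<epsilon> s d l \<rho> A G'. 0 \<le> \<epsilon> \<Longrightarrow> \<epsilon> \<le> \<epsilon>\<^sub>0 \<Longrightarrow> s - A *v d + \<rho> + G' *v l = 0 \<Longrightarrow>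
       norm (A *v d - H *v d) \<le> \<epsilon> * norm d \<Longrightarrow> norm \<rho> \<le> \<epsilon> * norm d \<Longrightarrow>
       norm (G' *v l - G \<theta>\<^sub>0 *v l) \<le> \<epsilon> * norm l \<Longrightarrow>
       norm (transpose (G \<theta>\<^sub>0) *v d) \<le> \<epsilon> * norm d \<Longrightarrow>
       norm (d - P *v s) \<le> C * \<epsilon> * norm s"
    using perturbed_restricted_equations[OF P_matrix_identities[OF H_pd inj] inj, folded P_def]
    by (metis (no_types))

  have linear: "with_probability_tending_to_one M
      (\<lambda>n \<omega>. norm (X n \<omega> - P *v s n \<omega>) \<le> e * norm (s n \<omega>))" if "e > 0" for e
  proof -
    define \<epsilon> where "\<epsilon> = min \<epsilon>\<^sub>0 (e / C)"
    have \<epsilon>: "0 < \<epsilon>" "\<epsilon> \<le> \<epsilon>\<^sub>0" "C * \<epsilon> \<le> e"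
      using C that by (auto simp: \<epsilon>_def min_def field_simps)
    \<comment> \<open>An upper bound for the average of \<open>B\<close> as soon as it is within 1
      of its mean; the absolute value keeps \<open>b\<close> positive.\<close>
    define b where "b = \<bar>integral\<^sup>L L B\<bar> + 1"
    have b: "0 < b" by (simp add: b_def)
    have "isCont G \<theta>\<^sub>0"
      using G_continuous true_interior by (simp add: continuous_on_eq_continuous_at)
    then obtain \<delta>1 where \<delta>1: "\<delta>1 > 0"
      "\<And>x. dist x \<theta>\<^sub>0 < \<delta>1 \<Longrightarrow> dist (G x) (G \<theta>\<^sub>0) < \<epsilon> / (p * q)"
      using \<epsilon>(1) p q unfolding continuous_at_eps_delta by (metis divide_pos_pos mult_pos_pos)
    have "(g has_derivative frechet_derivative g (at \<theta>\<^sub>0)) (at \<theta>\<^sub>0)"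
      using G_exists[OF true_interior] by (simp add: frechet_derivative_works)
    then obtain \<delta>2 where \<delta>2: "\<delta>2 > 0"
      "\<And>x. norm (x - \<theta>\<^sub>0) < \<delta>2 \<Longrightarrow>
        norm (g x - g \<theta>\<^sub>0 - frechet_derivative g (at \<theta>\<^sub>0) (x - \<theta>\<^sub>0)) \<le> \<epsilon> * norm (x - \<theta>\<^sub>0)"
      using \<epsilon>(1) unfolding has_derivative_at_alt by blast
    \<comment> \<open>The four radii serve the score expansion, the continuity of G, the
      differentiability of g at the true parameter, and the reduction of the quadratic remainder to
      relative size \<epsilon>.\<close>
    define \<delta> where "\<delta> = Min {r, \<delta>1, \<delta>2, \<epsilon> / (p ^ 3 * b)}"
    have \<delta>: "\<delta> \<le> r" "\<delta> \<le> \<delta>1" "\<delta> \<le> \<delta>2" "\<delta> \<le> \<epsilon> / (p ^ 3 * b)"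
      by (auto simp: \<delta>_def)
    have "\<delta> > 0"
      using r(1) \<delta>1(1) \<delta>2(1) \<epsilon>(1) p b by (simp add: \<delta>_def)
    have av: "with_probability_tending_to_one M (\<lambda>n \<omega>. dist ((\<Sum>k<n. \<phi> (Y k \<omega>)) / real n) (integral\<^sup>L L \<phi>) < \<kappa>)"
      if "integrable L \<phi>" "\<kappa> > 0" for \<phi> \<kappa>
    proof (rule with_probability_tending_to_one_dist_less)
      have "\<phi> \<in> borel_measurable borel"
        using borel_measurable_integrable[OF that(1)] Y_law[of 0] by auto
      then show "random_variable borel (\<lambda>\<omega>. (\<Sum>k<n. \<phi> (Y k \<omega>)) / real n)" for n
        by measurable
      show "converges_in_probability M (\<lambda>n \<omega>. (\<Sum>k<n. \<phi> (Y k \<omega>)) / real n) (integral\<^sup>L L \<phi>)"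
        by (rule converges_in_probability_average[OF Y_indep Y_law that(1)])
    qed fact
    have \<kappa>: "0 < \<epsilon> / (p * p)" using \<epsilon>(1) p by simp
    have hess: "with_probability_tending_to_one M (\<lambda>n \<omega>. \<forall>ij\<in>UNIV.
        dist ((\<Sum>k<n. a (fst ij) (snd ij) (Y k \<omega>)) / real n) (integral\<^sup>L L (a (fst ij) (snd ij))) < \<epsilon> / (p * p))"
      by (rule with_probability_tending_to_one_ball[OF finite])
        (intro av[OF _ \<kappa>], use H_finite in \<open>simp add: a_def[abs_def]\<close>)
    show ?thesis
    proof (rule with_probability_tending_to_one_mono[OF
          with_probability_tending_to_one_conj[OF est_restricted
          with_probability_tending_to_one_conj[OF
            with_probability_tending_to_one_dist_less[OF est est_consistent \<open>\<delta> > 0\<close>]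
          with_probability_tending_to_one_conj[OF hess
          with_probability_tending_to_one_conj[OF av[OF B_int zero_less_one]
            with_probability_tending_to_one_AE[OF goodY]]]]]], elim conjE)
      fix n \<omega>
      assume n: "0 < n"
        and rle: "restricted_likelihood_equations g cl n (\<lambda>i. Y i \<omega>) (est n \<omega>)"
        and near: "dist (est n \<omega>) \<theta>\<^sub>0 < \<delta>"
        and hess: "\<forall>ij\<in>UNIV. dist ((\<Sum>k<n. a (fst ij) (snd ij) (Y k \<omega>)) / real n)
          (integral\<^sup>L L (a (fst ij) (snd ij))) < \<epsilon> / (p * p)"
        and Bav: "dist ((\<Sum>k<n. B (Y k \<omega>)) / real n) (integral\<^sup>L L B) < 1"
        and good: "\<forall>k. continuously_differentiable 3 U (\<lambda>\<theta>. cl \<theta> (Y k \<omega>)) \<and>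
          (\<forall>\<theta>\<in>U. \<forall>i j l. \<bar>partial i (partial j (partial l (\<lambda>t. cl t (Y k \<omega>)))) \<theta>\<bar> \<le> B (Y k \<omega>))"
      define v where "v = est n \<omega> - \<theta>\<^sub>0"
      have v: "norm v < \<delta>" "est n \<omega> = \<theta>\<^sub>0 + v"
        using near by (auto simp: v_def dist_norm)
      let ?n = "sqrt (real n)"
      have sn: "0 < ?n" "?n * ?n = real n" using n by auto
      have d: "X n \<omega> = ?n *\<^sub>R v" "norm (X n \<omega>) = ?n * norm v"
        by (simp_all add: X_def v_def)
      obtain lam where lam: "(\<Sum>i<n. score cl (est n \<omega>) (Y i \<omega>)) + G (est n \<omega>) *v lam = 0"
        and g0: "g (est n \<omega>) = 0"
        using rle unfolding restricted_likelihood_equations_def G_eq by blast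
      \<comment> \<open>The likelihood equations are divided by the square root of n, which puts the
        multiplier on the scale of the normalized score.\<close>
      define l where "l = lam /\<^sub>R ?n"
      define A where "A = (\<chi> j i. - ((\<Sum>k<n. partial i (\<lambda>t. score cl t (Y k \<omega>) $ j) \<theta>\<^sub>0) / real n))"
      define R where "R = (\<Sum>k<n. score cl (\<theta>\<^sub>0 + v) (Y k \<omega>)) - (\<Sum>k<n. score cl \<theta>\<^sub>0 (Y k \<omega>)) + real n *\<^sub>R (A *v v)"
      define \<rho> where "\<rho> = R /\<^sub>R ?n"
      have Ad: "A *v X n \<omega> = (real n *\<^sub>R (A *v v)) /\<^sub>R ?n"
        using sn by (simp add: d(1) matrix_vector_mult_scaleR field_simps)
      have "norm (X n \<omega> - P *v s n \<omega>) \<le> C * \<epsilon> * norm (s n \<omega>)"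
      proof (rule solve)
        have "s n \<omega> - A *v X n \<omega> + \<rho> + G (est n \<omega>) *v l =
            ((\<Sum>i<n. score cl (est n \<omega>) (Y i \<omega>)) + G (est n \<omega>) *v lam) /\<^sub>R ?n"
          by (simp add: s_def Ad \<rho>_def R_def l_def \<psi>_def v(2)[symmetric] matrix_vector_mult_scaleR
              scaleR_add_right scaleR_diff_right del: scaleR_scaleR)
        then show "s n \<omega> - A *v X n \<omega> + \<rho> + G (est n \<omega>) *v l = 0"
          by (simp add: lam)
      next
        have "\<bar>(A - H) $ i $ j\<bar> \<le> \<epsilon> / (p * p)" for i j
          using hess[rule_format, of "(j, i)"] H_entry[of j i] H_sym[of i j]
          by (simp add: A_def a_def dist_real_def)
        from norm_matrix_vector_le_entries[OF this, of "X n \<omega>"]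
        show "norm (A *v X n \<omega> - H *v X n \<omega>) \<le> \<epsilon> * norm (X n \<omega>)"
          using p by (simp add: p_def[symmetric] matrix_vector_mult_diff_rdistrib)
      next
        have "norm R \<le> p ^ 3 * (\<Sum>k<n. B (Y k \<omega>)) * (norm v)\<^sup>2"
          unfolding R_def p_def
          by (rule score_sum_expansion[OF _ _ r(2) _ n A_def]) (use good v \<delta> in auto)
        \<comment> \<open>One of the two factors \<open>norm v\<close> is traded for \<delta>; the
          other, multiplied by the square root of n, is \<open>norm (X n \<omega>)\<close>.\<close>
        also have "\<dots> \<le> p ^ 3 * (real n * b) * (\<delta> * norm v)"
        proof (intro mult_mono mult_left_mono)
          have "(\<Sum>k<n. B (Y k \<omega>)) / real n \<le> b"
            using Bav by (simp add: b_def dist_real_def abs_if split: if_splits)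
          then show "(\<Sum>k<n. B (Y k \<omega>)) \<le> real n * b"
            using n by (simp add: field_simps)
          show "(norm v)\<^sup>2 \<le> \<delta> * norm v"
            using v(1) by (simp add: power2_eq_square mult_right_mono)
          \<comment> \<open>Each \<open>B (Y k \<omega>)\<close> dominates an absolute value at the
            true parameter, hence is nonnegative.\<close>
          show "0 \<le> (\<Sum>k<n. B (Y k \<omega>))"
            using good U(2) by (intro sum_nonneg) (blast intro: order.trans[OF abs_ge_zero])
        qed (use p b in auto)
        also have "\<dots> = (p ^ 3 * b * \<delta>) * (real n * norm v)"
          by simp
        also have "\<dots> \<le> \<epsilon> * (real n * norm v)"
          using \<delta>(4) p b by (intro mult_right_mono) (auto simp: field_simps)
        also have "\<dots> = (\<epsilon> * norm (X n \<omega>)) * ?n"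
          unfolding d(2) using arg_cong[OF sn(2), of "\<lambda>x. \<epsilon> * (x * norm v)"] by (simp only: mult_ac)
        finally show "norm \<rho> \<le> \<epsilon> * norm (X n \<omega>)"
          using sn(1) by (simp add: \<rho>_def field_simps)
      next
        have "\<bar>(G (est n \<omega>) - G \<theta>\<^sub>0) $ i $ j\<bar> \<le> \<epsilon> / (p * q)" for i j
        proof -
          have "\<bar>(G (est n \<omega>) - G \<theta>\<^sub>0) $ i $ j\<bar> \<le> norm (G (est n \<omega>) - G \<theta>\<^sub>0)"
            by (rule order.trans[OF component_le_norm_cart Finite_Cartesian_Product.norm_nth_le])
          also have "\<dots> \<le> \<epsilon> / (p * q)"
            using \<delta>1(2)[of "est n \<omega>"] near \<delta>(2) by (simp add: dist_norm)
          finally show ?thesis .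
        qed
        from norm_matrix_vector_le_entries[OF this, of l]
        show "norm (G (est n \<omega>) *v l - G \<theta>\<^sub>0 *v l) \<le> \<epsilon> * norm l"
          using p q by (simp add: p_def[symmetric] q_def[symmetric] matrix_vector_mult_diff_rdistrib)
      next
        have "transpose (G \<theta>\<^sub>0) *v X n \<omega> = ?n *\<^sub>R frechet_derivative g (at \<theta>\<^sub>0) v"
          unfolding d(1) G_eq
          by (simp add: matrix_vector_mult_scaleR transpose_constraint_matrix[OF G_exists[OF true_interior]]
              del: transpose_matrix_vector)
        moreover have "norm (frechet_derivative g (at \<theta>\<^sub>0) v) \<le> \<epsilon> * norm v"
          using \<delta>2(2)[of "est n \<omega>"] v \<delta>(3) g0[unfolded v(2)] by (simp add: true_constraint)
        ultimately show "norm (transpose (G \<theta>\<^sub>0) *v X n \<omega>) \<le> \<epsilon> * norm (X n \<omega>)"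
          using sn(1) by (simp add: d(2) mult.left_commute)
      qed (use \<epsilon> in auto)
      also have "\<dots> \<le> e * norm (s n \<omega>)"
        using \<epsilon>(3) by (rule mult_right_mono) simp
      finally show "norm (X n \<omega> - P *v s n \<omega>) \<le> e * norm (s n \<omega>)" .
    qed
  qed

  have "\<exists>N. is_multivariate_normal 0 (P ** J ** transpose P) N \<and> converges_in_law M X N"
  proof (rule asymptotically_linear_normal[OF Y_indep Y_law])
    show "integrable L (\<lambda>y. \<psi> y $ i)" "(\<integral>y. \<psi> y $ i \<partial>L) = 0" for i
      using score_integrable score_mean by (simp_all add: \<psi>_def)
    show "integrable L (\<lambda>y. \<psi> y $ i * \<psi> y $ j)" for i j
      using J_finite by (simp add: \<psi>_def)
    \<comment> \<open>The covariance is centred by definition; with mean zero it reduces to the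
      matrix of second moments.\<close>
    show "J $ i $ j = (\<integral>y. \<psi> y $ i * \<psi> y $ j \<partial>L)" for i j
      by (simp add: J_eq variability_matrix_def score_mean \<psi>_def)
    show "random_variable borel (X n)" for n
      unfolding X_def by measurable
  qed (use J_pd linear in \<open>auto simp: s_def\<close>)
  then show ?thesis
    by (simp add: P_def X_def[abs_def])
qed

end
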